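(* Let $g,h$ be positive integers, $\Omega=X+iY\in\mathbb{H}_g$ with $X,Y$ real, $L_\Omega=\mathbb{Z}^{(h,g)}+\mathbb{Z}^{(h,g)}\Omega$ and $A_\Omega=\mathbb{C}^{(h,g)}/L_\Omega$. Let $L^2(A_\Omega)$ be the Hilbert space of square-integrable functions on $A_\Omega$ with inner product $(f,g)_\Omega=\int_{A_\Omega}f\,\overline{g}\,dv_\Omega$, where $dv_\Omega$ is the translation-invariant volume element normalized so that $\int_{A_\Omega}dv_\Omega=1$. For $A,B\in\mathbb{Z}^{(h,g)}$ let $$E_{\Omega;A,B}(Z)=\exp\!\Big(2\pi i\big(\sigma({}^tA\,U)+\sigma((B-AX)Y^{-1}\,{}^tV)\big)\Big),\qquad Z=U+iV,\ U,V\in\mathbb{R}^{(h,g)}.$$ Then $\{E_{\Omega;A,B}\mid A,B\in\mathbb{Z}^{(h,g)}\}$ is a complete orthonormal basis of $L^2(A_\Omega)$. Moreover, each $E_{\Omega;A,B}$ is an eigenfunction of the Laplacian $\Delta_\Omega=\sigma\big(Y\,\frac{\partial}{\partial Z}\,{}^t\big(\frac{\partial}{\partial\overline Z}\big)\big)$, giving the spectral decomposition $$L^2(A_\Omega)=\bigoplus_{A,B\in\mathbb{Z}^{(h,g)}}\mathbb{C}\cdot E_{\Omega;A,B}.$$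
   Context: $\mathbb{H}_g=\{\Omega\in\mathbb{C}^{(g,g)}\mid\Omega={}^t\Omega,\ \mathrm{Im}\,\Omega>0\}$; $F^{(k,l)}$ denotes $k\times l$ matrices over $F$; $\sigma$ is the trace, ${}^t$ the transpose. The functions $E_{\Omega;A,B}$ are $L_\Omega$-periodic, hence functions on $A_\Omega$. For $Z=(z_{kl})\in\mathbb{C}^{(h,g)}$, $\frac{\partial}{\partial Z}$ is the $g\times h$ matrix whose $(l,k)$ entry is $\frac{\partial}{\partial z_{kl}}$, and $\frac{\partial}{\partial\overline Z}$ is the $g\times h$ matrix whose $(l,k)$ entry is $\frac{\partial}{\partial\bar z_{kl}}$ (Wirtinger derivatives). The direct sum is the Hilbert space direct sum. *)

theory Defs
  imports "HOL-Analysis.Analysis"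
begin

text \<open>An \<open>h \<times> g\<close> matrix over \<open>F\<close> is an element of \<open>F^'g^'h\<close>.\<close>

definition siegel_upper_half_space :: "(complex^'g^'g) set" where
  "siegel_upper_half_space =
     {\<Omega>. transpose \<Omega> = \<Omega> \<and> (\<forall>x::real^'g. x \<noteq> 0 \<longrightarrow> x \<bullet> (map_matrix Im \<Omega> *v x) > 0)}"

definition period_lattice :: "complex^'g^'g \<Rightarrow> (complex^'g^'h) set" where
  "period_lattice \<Omega> =
     {map_matrix of_int P + map_matrix of_int Q ** \<Omega> | P Q :: int^'g^'h. True}"

definition period_rel :: "complex^'g^'g \<Rightarrow> ((complex^'g^'h) \<times> (complex^'g^'h)) set" where
  "period_rel \<Omega> = {(Z, W). W - Z \<in> period_lattice \<Omega>}"

definition torus :: "complex^'g^'g \<Rightarrow> (complex^'g^'h) set set" where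
  "torus \<Omega> = UNIV // period_rel \<Omega>"

definition torus_proj :: "complex^'g^'g \<Rightarrow> complex^'g^'h \<Rightarrow> (complex^'g^'h) set" where
  "torus_proj \<Omega> Z = period_rel \<Omega> `` {Z}"

text \<open>The Borel sets of the quotient topology; the preimage of \<open>S\<close> under the projection is \<open>\<Union>S\<close>.\<close>

definition torus_borel :: "complex^'g^'g \<Rightarrow> (complex^'g^'h) set measure" where
  "torus_borel \<Omega> = sigma (torus \<Omega>) {S. S \<subseteq> torus \<Omega> \<and> open (\<Union>S)}"

definition normalized_invariant_volume ::
    "complex^'g^'g \<Rightarrow> (complex^'g^'h) set measure \<Rightarrow> bool" where
  "normalized_invariant_volume \<Omega> dv \<longleftrightarrow>
     space dv = torus \<Omega> \<and> sets dv = sets (torus_borel \<Omega>) \<and>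
     (\<forall>a. \<forall>S\<in>sets dv. emeasure dv ((`) ((+) a) ` S) = emeasure dv S) \<and>
     emeasure dv (torus \<Omega>) = 1"

definition lattice_char ::
    "complex^'g^'g \<Rightarrow> int^'g^'h \<Rightarrow> int^'g^'h \<Rightarrow> complex^'g^'h \<Rightarrow> complex" where
  "lattice_char \<Omega> A B Z =
     (let X = map_matrix Re \<Omega>; Y = map_matrix Im \<Omega>;
          U = map_matrix Re Z; V = map_matrix Im Z;
          A' = map_matrix real_of_int A; B' = map_matrix real_of_int B
      in exp (2 * pi * \<i> *
           complex_of_real (trace (transpose A' ** U)
             + trace ((B' - A' ** X) ** matrix_inv Y ** transpose V))))"

text \<open>The induced function on the torus: a periodic function is constant on each coset, so its image
  of a coset is a singleton (see \<open>torus_char_proj\<close> below).\<close>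

definition torus_char ::
    "complex^'g^'g \<Rightarrow> int^'g^'h \<Rightarrow> int^'g^'h \<Rightarrow> (complex^'g^'h) set \<Rightarrow> complex" where
  "torus_char \<Omega> A B C = the_elem (lattice_char \<Omega> A B ` C)"

definition dir_deriv :: "'v::real_normed_vector \<Rightarrow> ('v \<Rightarrow> complex) \<Rightarrow> 'v \<Rightarrow> complex" where
  "dir_deriv v f x = frechet_derivative f (at x) v"

definition smooth_fun :: "('v::real_normed_vector \<Rightarrow> complex) \<Rightarrow> bool" where
  "smooth_fun f \<longleftrightarrow> (\<forall>vs x. foldr dir_deriv vs f differentiable (at x))"

text \<open>\<open>d_dZ l k\<close> and \<open>d_dZbar l k\<close> are the \<open>(l,k)\<close> entries of the \<open>g \<times> h\<close> operator matrices,
  that is, the Wirtinger derivatives with respect to \<open>Z $ k $ l\<close>.\<close>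

definition d_dZ :: "'g \<Rightarrow> 'h \<Rightarrow> (complex^'g^'h \<Rightarrow> complex) \<Rightarrow> complex^'g^'h \<Rightarrow> complex" where
  "d_dZ l k f Z =
     (dir_deriv (axis k (axis l 1)) f Z - \<i> * dir_deriv (axis k (axis l \<i>)) f Z) / 2"

definition d_dZbar :: "'g \<Rightarrow> 'h \<Rightarrow> (complex^'g^'h \<Rightarrow> complex) \<Rightarrow> complex^'g^'h \<Rightarrow> complex" where
  "d_dZbar l k f Z =
     (dir_deriv (axis k (axis l 1)) f Z + \<i> * dir_deriv (axis k (axis l \<i>)) f Z) / 2"

definition laplacian ::
    "complex^'g^'g \<Rightarrow> (complex^'g^'h \<Rightarrow> complex) \<Rightarrow> complex^'g^'h \<Rightarrow> complex" where
  "laplacian \<Omega> f Z =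
     trace (map_matrix complex_of_real (map_matrix Im \<Omega>) **
            (\<chi> l m. \<Sum>k\<in>UNIV. d_dZ l k (d_dZbar m k f) Z))"

text \<open>Differential operators act on functions on the torus through their periodic lifts.\<close>

definition laplacian_eigenfunction ::
    "complex^'g^'g \<Rightarrow> ((complex^'g^'h) set \<Rightarrow> complex) \<Rightarrow> bool" where
  "laplacian_eigenfunction \<Omega> f \<longleftrightarrow>
     smooth_fun (\<lambda>Z. f (torus_proj \<Omega> Z)) \<and>
     (\<exists>Z. f (torus_proj \<Omega> Z) \<noteq> 0) \<and>
     (\<exists>\<mu>. \<forall>Z. laplacian \<Omega> (\<lambda>W. f (torus_proj \<Omega> W)) Z = \<mu> * f (torus_proj \<Omega> Z))"

text \<open>The elements of \<open>L2 M\<close> are classes of measurable functions modulo equality almost everywhere. All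
  operations are defined on representatives; none depends on the choice of representative.\<close>

definition ae_class :: "'a measure \<Rightarrow> ('a \<Rightarrow> complex) \<Rightarrow> ('a \<Rightarrow> complex) set" where
  "ae_class M f = {f' \<in> borel_measurable M. AE x in M. f' x = f x}"

definition ae_rep :: "('a \<Rightarrow> complex) set \<Rightarrow> 'a \<Rightarrow> complex" where
  "ae_rep F = (SOME f. f \<in> F)"

definition L2 :: "'a measure \<Rightarrow> ('a \<Rightarrow> complex) set set" where
  "L2 M = ae_class M ` {f \<in> borel_measurable M. integrable M (\<lambda>x. (cmod (f x))\<^sup>2)}"

definition L2_inner :: "'a measure \<Rightarrow> ('a \<Rightarrow> complex) set \<Rightarrow> ('a \<Rightarrow> complex) set \<Rightarrow> complex" where
  "L2_inner M F G = (LINT x|M. ae_rep F x * cnj (ae_rep G x))"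

definition L2_dist :: "'a measure \<Rightarrow> ('a \<Rightarrow> complex) set \<Rightarrow> ('a \<Rightarrow> complex) set \<Rightarrow> real" where
  "L2_dist M F G = sqrt (LINT x|M. (cmod (ae_rep F x - ae_rep G x))\<^sup>2)"

definition L2_lincomb ::
    "'a measure \<Rightarrow> 'i set \<Rightarrow> ('i \<Rightarrow> complex) \<Rightarrow> ('i \<Rightarrow> ('a \<Rightarrow> complex) set) \<Rightarrow> ('a \<Rightarrow> complex) set" where
  "L2_lincomb M J c F = ae_class M (\<lambda>x. \<Sum>j\<in>J. c j * ae_rep (F j) x)"

definition L2_complete_orthonormal_basis ::
    "'a measure \<Rightarrow> 'i set \<Rightarrow> ('i \<Rightarrow> ('a \<Rightarrow> complex) set) \<Rightarrow> bool" where
  "L2_complete_orthonormal_basis M I e \<longleftrightarrow>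
     (\<forall>i\<in>I. e i \<in> L2 M) \<and>
     (\<forall>i\<in>I. \<forall>j\<in>I. L2_inner M (e i) (e j) = (if i = j then 1 else 0)) \<and>
     (\<forall>F\<in>L2 M. \<forall>\<epsilon>>0. \<exists>J c. finite J \<and> J \<subseteq> I \<and> L2_dist M (L2_lincomb M J c e) F < \<epsilon>)"

definition L2_closed_subspace :: "'a measure \<Rightarrow> ('a \<Rightarrow> complex) set set \<Rightarrow> bool" where
  "L2_closed_subspace M V \<longleftrightarrow>
     V \<subseteq> L2 M \<and>
     (\<forall>(J::nat set) c F. finite J \<and> (\<forall>j\<in>J. F j \<in> V) \<longrightarrow> L2_lincomb M J c F \<in> V) \<and>
     (\<forall>(S::nat \<Rightarrow> _). \<forall>F\<in>L2 M. (\<forall>n. S n \<in> V) \<and> (\<lambda>n. L2_dist M (S n) F) \<longlonglongrightarrow> 0 \<longrightarrow> F \<in> V)"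

text \<open>\<open>L2 M\<close> is the internal Hilbert space direct sum of the subspaces \<open>V i\<close>; the sum over \<open>I\<close>
  converges unconditionally in norm.\<close>

definition L2_hilbert_direct_sum ::
    "'a measure \<Rightarrow> 'i set \<Rightarrow> ('i \<Rightarrow> ('a \<Rightarrow> complex) set set) \<Rightarrow> bool" where
  "L2_hilbert_direct_sum M I V \<longleftrightarrow>
     (\<forall>i\<in>I. L2_closed_subspace M (V i)) \<and>
     (\<forall>i\<in>I. \<forall>j\<in>I. i \<noteq> j \<longrightarrow> (\<forall>F\<in>V i. \<forall>G\<in>V j. L2_inner M F G = 0)) \<and>
     (\<forall>F\<in>L2 M. \<exists>!v. v \<in> Pi\<^sub>E I V \<and>
        ((\<lambda>J. L2_dist M (L2_lincomb M J (\<lambda>_. 1) v) F) \<longlongrightarrow> 0) (finite_subsets_at_top I))"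

definition L2_line :: "'a measure \<Rightarrow> ('a \<Rightarrow> complex) set \<Rightarrow> ('a \<Rightarrow> complex) set set" where
  "L2_line M F = {ae_class M (\<lambda>x. c * ae_rep F x) | c. True}"

lemma siegel_inverse:
  fixes \<Omega> :: "complex^'g^'g"
  assumes "\<Omega> \<in> siegel_upper_half_space"
  shows "map_matrix Im \<Omega> ** matrix_inv (map_matrix Im \<Omega>) = mat 1"
    and "matrix_inv (map_matrix Im \<Omega>) ** map_matrix Im \<Omega> = mat 1"
proof -
  let ?Y = "map_matrix Im \<Omega>"
  have "x = 0" if "?Y *v x = 0" for x
    using assms that by (force simp: siegel_upper_half_space_def)
  then obtain B where "B ** ?Y = mat 1"
    using matrix_left_invertible_ker by blast
  then have "\<exists>B. ?Y ** B = mat 1 \<and> B ** ?Y = mat 1"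
    using matrix_left_right_inverse by blast
  from someI_ex[OF this]
  show "?Y ** matrix_inv ?Y = mat 1" "matrix_inv ?Y ** ?Y = mat 1"
    by (simp_all add: matrix_inv_def)
qed

lemma Re_of_int_mult [simp]:
  "map_matrix Re (map_matrix of_int Q ** \<Omega>) = map_matrix real_of_int Q ** map_matrix Re \<Omega>"
  by (simp add: vec_eq_iff matrix_matrix_mult_def)

lemma Im_of_int_mult [simp]:
  "map_matrix Im (map_matrix of_int Q ** \<Omega>) = map_matrix real_of_int Q ** map_matrix Im \<Omega>"
  by (simp add: vec_eq_iff matrix_matrix_mult_def)

lemma period_lattice_0: "0 \<in> period_lattice \<Omega>"
proof -
  have "0 = map_matrix of_int 0 + map_matrix of_int 0 ** \<Omega>"
    by (simp add: vec_eq_iff matrix_matrix_mult_def)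
  then show ?thesis unfolding period_lattice_def by blast
qed

lemma period_lattice_diff:
  assumes "a \<in> period_lattice \<Omega>" "b \<in> period_lattice \<Omega>"
  shows "a - b \<in> period_lattice \<Omega>"
proof -
  obtain P Q P' Q' where a: "a = map_matrix of_int P + map_matrix of_int Q ** \<Omega>"
    and b: "b = map_matrix of_int P' + map_matrix of_int Q' ** \<Omega>"
    using assms unfolding period_lattice_def by blast
  have "a - b = map_matrix of_int (P - P') + map_matrix of_int (Q - Q') ** \<Omega>"
    unfolding a b by (simp add: vec_eq_iff matrix_matrix_mult_def algebra_simps sum_subtractf)
  then show ?thesis unfolding period_lattice_def by blast
qed

lemma period_lattice_minus: "a \<in> period_lattice \<Omega> \<Longrightarrow> - a \<in> period_lattice \<Omega>"
  using period_lattice_diff[OF period_lattice_0] by fastforce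

lemma period_lattice_add:
  "a \<in> period_lattice \<Omega> \<Longrightarrow> b \<in> period_lattice \<Omega> \<Longrightarrow> a + b \<in> period_lattice \<Omega>"
  using period_lattice_diff[OF _ period_lattice_minus] by fastforce

lemma equiv_period_rel: "equiv UNIV (period_rel \<Omega>)"
proof (rule equivI)
  show "sym (period_rel \<Omega>)"
    unfolding period_rel_def sym_def using period_lattice_minus by fastforce
  show "trans (period_rel \<Omega>)"
    unfolding period_rel_def trans_def using period_lattice_add by fastforce
qed (auto simp: period_rel_def refl_on_def period_lattice_0)

lemma torus_proj_iff: "W \<in> torus_proj \<Omega> Z \<longleftrightarrow> W - Z \<in> period_lattice \<Omega>"
  by (simp add: torus_proj_def period_rel_def)

lemma lattice_char_periodic:
  fixes \<Omega> :: "complex^'g^'g" and A B :: "int^'g^'h"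
  assumes \<Omega>: "\<Omega> \<in> siegel_upper_half_space" and "l \<in> period_lattice \<Omega>"
  shows "lattice_char \<Omega> A B (Z + l) = lattice_char \<Omega> A B Z"
proof -
  obtain P Q where l: "l = map_matrix of_int P + map_matrix of_int Q ** \<Omega>"
    using assms(2) unfolding period_lattice_def by blast
  define X Y where "X = map_matrix Re \<Omega>" and "Y = map_matrix Im \<Omega>"
  define U V where "U = map_matrix Re Z" and "V = map_matrix Im Z"
  define A' B' P' Q' where "A' = map_matrix real_of_int A" and "B' = map_matrix real_of_int B"
    and "P' = map_matrix real_of_int P" and "Q' = map_matrix real_of_int Q"
  note defs = X_def Y_def U_def V_def A'_def B'_def P'_def Q'_def
  have sym: "transpose X = X" "transpose Y = Y"
    using \<Omega> by (auto simp: siegel_upper_half_space_def defs transpose_def vec_eq_iff)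
  have inv: "matrix_inv Y ** Y = mat 1"
    using siegel_inverse[OF \<Omega>] by (simp add: defs)
  have U: "map_matrix Re (Z + l) = U + (P' + Q' ** X)"
    by (simp add: l defs vec_eq_iff matrix_matrix_mult_def)
  have V: "map_matrix Im (Z + l) = V + Q' ** Y"
    by (simp add: l defs vec_eq_iff matrix_matrix_mult_def)
  have tr: "transpose (V + Q' ** Y) = transpose V + Y ** transpose Q'"
  proof -
    have "transpose (V + Q' ** Y) = transpose V + transpose (Q' ** Y)"
      by (simp add: transpose_def vec_eq_iff)
    then show ?thesis by (simp add: matrix_transpose_mul sym)
  qed
  have c: "trace (transpose A' ** (Q' ** X)) = trace (A' ** X ** transpose Q')"
  proof -
    have "trace (transpose A' ** (Q' ** X)) = trace (transpose (transpose A' ** (Q' ** X)))"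
      by (simp add: trace_def transpose_def)
    also have "\<dots> = trace (X ** transpose Q' ** A')"
      by (simp add: matrix_transpose_mul sym transpose_transpose)
    also have "\<dots> = trace (A' ** (X ** transpose Q'))"
      by (rule trace_mul_sym)
    finally show ?thesis by (simp add: matrix_mul_assoc)
  qed
  have "trace (transpose A' ** (U + (P' + Q' ** X)))
           + trace ((B' - A' ** X) ** matrix_inv Y ** (transpose V + Y ** transpose Q'))
      = trace (transpose A' ** U) + trace ((B' - A' ** X) ** matrix_inv Y ** transpose V)
        + (trace (transpose A' ** P') + trace (transpose A' ** (Q' ** X))
        + trace ((B' - A' ** X) ** (matrix_inv Y ** Y) ** transpose Q'))"
    by (simp only: matrix_add_ldistrib trace_add matrix_mul_assoc)
  also have "\<dots> = trace (transpose A' ** U) + trace ((B' - A' ** X) ** matrix_inv Y ** transpose V)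
        + (trace (transpose A' ** P') + trace (B' ** transpose Q'))"
  proof -
    have "(B' - A' ** X) ** transpose Q' = B' ** transpose Q' - A' ** X ** transpose Q'"
      by (simp add: vec_eq_iff matrix_matrix_mult_def algebra_simps sum_subtractf)
    then show ?thesis unfolding inv c by (simp add: trace_sub)
  qed
  finally have *: "trace (transpose A' ** (U + (P' + Q' ** X)))
           + trace ((B' - A' ** X) ** matrix_inv Y ** (transpose V + Y ** transpose Q'))
    = trace (transpose A' ** U) + trace ((B' - A' ** X) ** matrix_inv Y ** transpose V)
        + (trace (transpose A' ** P') + trace (B' ** transpose Q'))" .
  have "trace (transpose A' ** P') + trace (B' ** transpose Q') \<in> \<int>"
    by (auto simp: trace_def matrix_matrix_mult_def transpose_def defs
          intro!: Ints_add Ints_sum Ints_mult)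
  then obtain n where n: "trace (transpose A' ** P') + trace (B' ** transpose Q') = real_of_int n"
    by (elim Ints_cases)
  show ?thesis
    unfolding lattice_char_def Let_def U V tr defs[symmetric] * n
    using exp_integer_2pi[of "of_int n"]
    by (simp add: distrib_left exp_add mult_ac)
qed

lemma torus_char_proj:
  fixes \<Omega> :: "complex^'g^'g" and A B :: "int^'g^'h"
  assumes "\<Omega> \<in> siegel_upper_half_space"
  shows "torus_char \<Omega> A B (torus_proj \<Omega> Z) = lattice_char \<Omega> A B Z"
proof -
  have "lattice_char \<Omega> A B ` torus_proj \<Omega> Z = {lattice_char \<Omega> A B Z}"
  proof (intro equalityI subsetI)
    fix y assume "y \<in> lattice_char \<Omega> A B ` torus_proj \<Omega> Z"
    then obtain W where "W - Z \<in> period_lattice \<Omega>" "y = lattice_char \<Omega> A B (Z + (W - Z))"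
      by (auto simp: torus_proj_iff)
    then show "y \<in> {lattice_char \<Omega> A B Z}"
      by (simp only: lattice_char_periodic[OF assms] singleton_iff)
  next
    have "Z \<in> torus_proj \<Omega> Z" by (simp add: torus_proj_iff period_lattice_0)
    then show "y \<in> lattice_char \<Omega> A B ` torus_proj \<Omega> Z" if "y \<in> {lattice_char \<Omega> A B Z}" for y
      using that by auto
  qed
  then show ?thesis by (simp add: torus_char_def)
qed

lemma norm_vec_le_l1: "norm x \<le> (\<Sum>i\<in>UNIV. norm (x $ i))"
  by (simp add: norm_vec_def L2_set_le_sum)

lemma emeasure_lborel_shift:
  fixes a :: "'v::euclidean_space"
  assumes "S \<in> sets borel"
  shows "emeasure lborel {Z. Z + a \<in> S} = emeasure lborel S"
proof -
  have "emeasure lborel S = emeasure (distr lborel borel ((+) a)) S"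
    by (simp add: lborel_distr_plus)
  also have "\<dots> = emeasure lborel {Z. Z + a \<in> S}"
    using assms by (subst emeasure_distr) (auto simp: vimage_def add.commute)
  finally show ?thesis by simp
qed

lemma fundamental_domains_emeasure_eq:
  fixes L F G T :: "'v::euclidean_space set"
  assumes L: "countable L" "\<And>l. l \<in> L \<Longrightarrow> - l \<in> L"
    and meas: "F \<in> sets borel" "G \<in> sets borel" "T \<in> sets borel"
    and F: "\<And>Z. \<exists>!l. l \<in> L \<and> Z + l \<in> F"
    and G: "\<And>Z. \<exists>!l. l \<in> L \<and> Z + l \<in> G"
    and T: "\<And>Z l. l \<in> L \<Longrightarrow> Z + l \<in> T \<longleftrightarrow> Z \<in> T"
  shows "emeasure lborel (F \<inter> T) = emeasure lborel (G \<inter> T)"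
proof -
  have sm: "{Z. Z + l \<in> S} \<in> sets borel" if "S \<in> sets borel" for S :: "'v set" and l
    using measurable_sets[of "\<lambda>Z. Z + l" borel borel S] that by (simp add: vimage_def)
  have decomp: "emeasure lborel (A \<inter> T) = (\<integral>\<^sup>+l. emeasure lborel (A \<inter> T \<inter> {Z. Z + l \<in> B}) \<partial>count_space L)"
    if A: "A \<in> sets borel" and B: "B \<in> sets borel" and u: "\<And>Z. \<exists>!l. l \<in> L \<and> Z + l \<in> B"
    for A B
  proof -
    have "A \<inter> T = (\<Union>l\<in>L. A \<inter> T \<inter> {Z. Z + l \<in> B})"
      using u by blast
    then have "emeasure lborel (A \<inter> T) = emeasure lborel (\<Union>l\<in>L. A \<inter> T \<inter> {Z. Z + l \<in> B})"
      by simp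
    also have "\<dots> = (\<integral>\<^sup>+l. emeasure lborel (A \<inter> T \<inter> {Z. Z + l \<in> B}) \<partial>count_space L)"
    proof (rule emeasure_UN_countable)
      show "disjoint_family_on (\<lambda>l. A \<inter> T \<inter> {Z. Z + l \<in> B}) L"
        unfolding disjoint_family_on_def using u by blast
      show "A \<inter> T \<inter> {Z. Z + l \<in> B} \<in> sets lborel" for l
        using A meas(3) sm[OF B, of l] by simp
    qed (rule L)
    finally show ?thesis .
  qed
  have shift: "emeasure lborel (F \<inter> T \<inter> {Z. Z + l \<in> G}) = emeasure lborel (G \<inter> T \<inter> {Z. Z + - l \<in> F})"
    if "l \<in> L" for l
  proof -
    have "{Z. Z + l \<in> G \<inter> T \<inter> {Z. Z + - l \<in> F}} = F \<inter> T \<inter> {Z. Z + l \<in> G}"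
      using T[OF that] by auto
    moreover have "G \<inter> T \<inter> {Z. Z + - l \<in> F} \<in> sets borel"
      using meas sm[OF meas(1), of "- l"] by blast
    ultimately show ?thesis
      using emeasure_lborel_shift by metis
  qed
  have "emeasure lborel (F \<inter> T) = (\<integral>\<^sup>+l. emeasure lborel (F \<inter> T \<inter> {Z. Z + l \<in> G}) \<partial>count_space L)"
    by (rule decomp[OF meas(1,2) G])
  also have "\<dots> = (\<integral>\<^sup>+l. emeasure lborel (G \<inter> T \<inter> {Z. Z + - l \<in> F}) \<partial>count_space L)"
    by (rule nn_integral_cong) (simp add: shift)
  also have "\<dots> = (\<integral>\<^sup>+l. emeasure lborel (G \<inter> T \<inter> {Z. Z + l \<in> F}) \<partial>count_space L)"
  proof (rule nn_integral_bij_count_space)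
    show "bij_betw uminus L L"
      by (rule bij_betw_byWitness[where f' = uminus]) (use L(2) in auto)
  qed
  also have "\<dots> = emeasure lborel (G \<inter> T)"
    by (rule decomp[OF meas(2,1) F, symmetric])
  finally show ?thesis .
qed

lemma torus_proj_in_torus: "torus_proj \<Omega> Z \<in> torus \<Omega>"
  by (simp add: torus_proj_def torus_def quotientI)

lemma torusE:
  assumes "C \<in> torus \<Omega>" obtains Z where "C = torus_proj \<Omega> Z"
  using assms unfolding torus_def torus_proj_def by (auto elim!: quotientE)

lemma torus_proj_eq_iff: "torus_proj \<Omega> Z = torus_proj \<Omega> W \<longleftrightarrow> W - Z \<in> period_lattice \<Omega>"
  using equiv_class_eq_iff[OF equiv_period_rel, of Z W \<Omega>]
  by (simp add: torus_proj_def period_rel_def)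

lemma in_Union_torus:
  assumes "S \<subseteq> torus \<Omega>" shows "Z \<in> \<Union>S \<longleftrightarrow> torus_proj \<Omega> Z \<in> S"
proof
  assume "Z \<in> \<Union>S"
  then obtain C where C: "C \<in> S" "Z \<in> C" by blast
  then obtain W where W: "C = torus_proj \<Omega> W" using assms torusE by blast
  then have "torus_proj \<Omega> W = torus_proj \<Omega> Z"
    using C by (simp add: torus_proj_iff torus_proj_eq_iff)
  then show "torus_proj \<Omega> Z \<in> S" using C W by simp
next
  assume "torus_proj \<Omega> Z \<in> S"
  then show "Z \<in> \<Union>S" using torus_proj_iff[of Z \<Omega> Z] period_lattice_0[of \<Omega>] by auto
qed

lemma translate_torus_proj: "(+) a ` torus_proj \<Omega> Z = torus_proj \<Omega> (a + Z)"
proof (intro equalityI subsetI)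
  fix W assume "W \<in> torus_proj \<Omega> (a + Z)"
  then have "W - a \<in> torus_proj \<Omega> Z" by (simp add: torus_proj_iff algebra_simps)
  then show "W \<in> (+) a ` torus_proj \<Omega> Z" by (metis add.commute diff_add_cancel imageI)
qed (auto simp: torus_proj_iff algebra_simps)

lemma space_torus_borel [simp]: "space (torus_borel \<Omega>) = torus \<Omega>"
  unfolding torus_borel_def by (rule space_measure_of) auto

lemma sets_torus_borel: "sets (torus_borel \<Omega>) = sigma_sets (torus \<Omega>) {S. S \<subseteq> torus \<Omega> \<and> open (\<Union>S)}"
  unfolding torus_borel_def by (rule sets_measure_of) auto

lemma torus_proj_measurable: "torus_proj \<Omega> \<in> measurable borel (torus_borel \<Omega>)"
  unfolding torus_borel_def
proof (rule measurable_measure_of)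
  fix S assume S: "S \<in> {S. S \<subseteq> torus \<Omega> \<and> open (\<Union>S)}"
  then have "torus_proj \<Omega> -` S = \<Union>S" using in_Union_torus[of S \<Omega>] by blast
  then show "torus_proj \<Omega> -` S \<inter> space borel \<in> sets borel" using S by simp
qed (auto simp: torus_proj_in_torus)

lemma translate_measurable: "(`) ((+) a) \<in> measurable (torus_borel \<Omega>) (torus_borel \<Omega>)"
proof -
  have fn: "(`) ((+) a) \<in> space (torus_borel \<Omega>) \<rightarrow> torus \<Omega>"
    by (auto elim!: torusE simp: translate_torus_proj torus_proj_in_torus)
  have "(`) ((+) a) -` S \<inter> torus \<Omega> \<in> sets (torus_borel \<Omega>)"
    if S: "S \<subseteq> torus \<Omega>" "open (\<Union>S)" for S
  proof -
    let ?R = "(`) ((+) a) -` S \<inter> torus \<Omega>"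
    have R: "?R \<subseteq> torus \<Omega>" by blast
    have "\<Union>?R = (+) a -` \<Union>S"
    proof (intro set_eqI)
      fix Z
      have "Z \<in> \<Union>?R \<longleftrightarrow> torus_proj \<Omega> Z \<in> ?R" by (rule in_Union_torus[OF R])
      also have "\<dots> \<longleftrightarrow> torus_proj \<Omega> (a + Z) \<in> S"
        by (simp add: translate_torus_proj torus_proj_in_torus)
      also have "\<dots> \<longleftrightarrow> a + Z \<in> \<Union>S" by (rule in_Union_torus[OF S(1), symmetric])
      finally show "Z \<in> \<Union>?R \<longleftrightarrow> Z \<in> (+) a -` \<Union>S" by simp
    qed
    moreover have "open ((+) a -` \<Union>S)"
      by (rule open_vimage[OF S(2)]) (intro continuous_intros)
    ultimately show ?thesis
      unfolding sets_torus_borel using R by (intro sigma_sets.Basic) simp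
  qed
  then show ?thesis
    by (subst (2) torus_borel_def) (rule measurable_measure_of, use fn in auto)
qed

text \<open>The hypothesis on the volume element is satisfiable.\<close>

lemma normalized_invariant_volume_exists:
  fixes \<Omega> :: "complex^'g^'g"
  assumes \<Omega>: "\<Omega> \<in> siegel_upper_half_space"
  shows "\<exists>dv :: (complex^'g^'h) set measure. normalized_invariant_volume \<Omega> dv"
proof -
  define X Y where "X = map_matrix Re \<Omega>" and "Y = map_matrix Im \<Omega>"
  define q where "q Z = map_matrix Im Z ** matrix_inv Y" for Z :: "complex^'g^'h"
  define p where "p Z = map_matrix Re Z - q Z ** X" for Z :: "complex^'g^'h"
  define lin where "lin P Q = map_matrix complex_of_real P + map_matrix complex_of_real Q ** \<Omega>"
    for P Q :: "real^'g^'h"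
  have inv: "Y ** matrix_inv Y = mat 1" "matrix_inv Y ** Y = mat 1"
    using siegel_inverse[OF \<Omega>] by (simp_all add: Y_def)
  have Re_lin: "map_matrix Re (lin P Q) = P + Q ** X" for P Q
    by (simp add: lin_def X_def vec_eq_iff matrix_matrix_mult_def)
  have Im_lin: "map_matrix Im (lin P Q) = Q ** Y" for P Q
    by (simp add: lin_def Y_def vec_eq_iff matrix_matrix_mult_def)
  have q_lin: "q (lin P Q) = Q" for P Q
    by (simp add: q_def Im_lin matrix_mul_assoc[symmetric] inv)
  have p_lin: "p (lin P Q) = P" for P Q
    by (simp add: p_def q_lin Re_lin)
  have lin_pq: "lin (p Z) (q Z) = Z" for Z
  proof -
    have "map_matrix Re (lin (p Z) (q Z)) = map_matrix Re Z"
      by (simp add: Re_lin p_def)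
    moreover have "map_matrix Im (lin (p Z) (q Z)) = map_matrix Im Z"
      by (simp add: Im_lin q_def matrix_mul_assoc[symmetric] inv)
    ultimately show ?thesis by (simp add: vec_eq_iff complex_eq_iff)
  qed
  have q_add: "q (Z + W) = q Z + q W" for Z W
    by (simp add: q_def vec_eq_iff matrix_matrix_mult_def algebra_simps sum.distrib)
  have p_add: "p (Z + W) = p Z + p W" for Z W
    by (simp add: p_def q_add vec_eq_iff matrix_matrix_mult_def algebra_simps sum.distrib)
  have q_cont: "continuous_on UNIV (\<lambda>Z. q Z $ i $ j)" for i j
    by (simp add: q_def matrix_matrix_mult_def) (intro continuous_intros)
  have p_cont: "continuous_on UNIV (\<lambda>Z. p Z $ i $ j)" for i j
    unfolding p_def matrix_matrix_mult_def vector_minus_component vec_lambda_beta nth_map_matrix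
    by (intro continuous_on_diff continuous_on_sum continuous_on_mult continuous_on_const q_cont
        continuous_intros)
  define F :: "(complex^'g^'h) set" where
    "F = {Z. \<forall>i j. 0 \<le> p Z $ i $ j \<and> p Z $ i $ j < 1 \<and> 0 \<le> q Z $ i $ j \<and> q Z $ i $ j < 1}"
  define F0 :: "(complex^'g^'h) set" where
    "F0 = {Z. \<forall>i j. 0 < p Z $ i $ j \<and> p Z $ i $ j < 1 \<and> 0 < q Z $ i $ j \<and> q Z $ i $ j < 1}"
  have [measurable]: "(\<lambda>Z. p Z $ i $ j) \<in> borel_measurable borel"
    "(\<lambda>Z. q Z $ i $ j) \<in> borel_measurable borel" for i j
    by (rule borel_measurable_continuous_onI[OF p_cont] borel_measurable_continuous_onI[OF q_cont])+
  have F_meas: "F \<in> sets borel"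
  proof -
    have "Measurable.pred borel (\<lambda>Z. \<forall>i j. 0 \<le> p Z $ i $ j \<and> p Z $ i $ j < 1 \<and> 0 \<le> q Z $ i $ j \<and> q Z $ i $ j < 1)"
      by measurable
    then show ?thesis unfolding F_def pred_def by simp
  qed
  have F0_open: "open F0"
  proof -
    have "F0 = (\<Inter>i. \<Inter>j. {Z. 0 < p Z $ i $ j \<and> p Z $ i $ j < 1 \<and> 0 < q Z $ i $ j \<and> q Z $ i $ j < 1})"
      by (auto simp: F0_def)
    moreover have "open {Z. 0 < p Z $ i $ j \<and> p Z $ i $ j < 1 \<and> 0 < q Z $ i $ j \<and> q Z $ i $ j < 1}" for i j
      by (intro open_Collect_conj open_Collect_less p_cont q_cont continuous_on_const)
    ultimately show ?thesis by (auto intro!: open_INT)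
  qed
  have "lin (\<chi> i j. 1/2) (\<chi> i j. 1/2) \<in> F0" by (simp add: F0_def p_lin q_lin)
  then have F_pos: "emeasure lborel F \<noteq> 0"
  proof -
    have sub: "F0 \<subseteq> F" by (auto simp: F0_def F_def less_imp_le)
    obtain a b where ab: "box a b \<subseteq> F0" "\<forall>i\<in>Basis. a \<bullet> i < b \<bullet> i"
      using open_contains_box[OF F0_open \<open>lin _ _ \<in> F0\<close>] by metis
    have "0 < (\<Prod>i\<in>Basis. b \<bullet> i - a \<bullet> i)"
      using ab(2) by (intro prod_pos) simp
    then have "emeasure lborel (box a b) \<noteq> 0"
      using ab(2) by (subst emeasure_lborel_box) (auto simp: less_imp_le inner_diff_left ennreal_eq_0_iff)
    moreover have "emeasure lborel (box a b) \<le> emeasure lborel F"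
      by (rule emeasure_mono) (use ab sub F_meas in auto)
    ultimately show ?thesis by auto
  qed
  have F_fin: "emeasure lborel F \<noteq> \<infinity>"
  proof -
    have "norm Z \<le> (\<Sum>i\<in>(UNIV :: 'h set). \<Sum>j\<in>UNIV. 1 + (\<Sum>k\<in>UNIV. norm (\<Omega> $ k $ j)))" (is "_ \<le> ?b")
      if "Z \<in> F" for Z
    proof -
      have "norm (Z $ i $ j) \<le> 1 + (\<Sum>k\<in>UNIV. norm (\<Omega> $ k $ j))" for i j
      proof -
        have pq: "\<bar>p Z $ i $ k\<bar> \<le> 1" "\<bar>q Z $ i $ k\<bar> \<le> 1" for k
          using that by (simp_all add: F_def abs_le_iff less_imp_le)
        have "Z $ i $ j = of_real (p Z $ i $ j) + (\<Sum>k\<in>UNIV. of_real (q Z $ i $ k) * \<Omega> $ k $ j)"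
          by (subst (1) lin_pq[symmetric]) (simp add: lin_def matrix_matrix_mult_def)
        also have "norm \<dots> \<le> 1 + (\<Sum>k\<in>UNIV. norm (\<Omega> $ k $ j))"
          using pq by (intro order.trans[OF norm_triangle_ineq] add_mono order.trans[OF norm_sum] sum_mono)
             (auto simp: norm_mult intro!: mult_left_le_one_le)
        finally show ?thesis .
      qed
      then show ?thesis
        by - (rule order.trans[OF norm_vec_le_l1], rule sum_mono, rule order.trans[OF norm_vec_le_l1],
            rule sum_mono, blast)
    qed
    then have "F \<subseteq> cball 0 ?b" by (auto simp: dist_norm)
    then have "bounded F" using bounded_cball bounded_subset by blast
    then show ?thesis using emeasure_bounded_finite[of F] by auto
  qed
  let ?L = "period_lattice \<Omega> :: (complex^'g^'h) set"
  have L_lin: "?L = (\<lambda>(P, Q). lin (map_matrix of_int P) (map_matrix of_int Q)) ` UNIV"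
  proof -
    have "map_matrix of_int P + map_matrix of_int Q ** \<Omega> = lin (map_matrix of_int P) (map_matrix of_int Q)"
      for P Q :: "int^'g^'h"
      by (simp add: lin_def vec_eq_iff matrix_matrix_mult_def)
    then show ?thesis by (auto simp: period_lattice_def)
  qed
  have L_count: "countable ?L" unfolding L_lin by (intro countable_image) simp
  have F_fund: "\<exists>!l. l \<in> ?L \<and> Z + l \<in> F" for Z
  proof (rule ex_ex1I)
    define P :: "int^'g^'h" where "P = (\<chi> i j. - \<lfloor>p Z $ i $ j\<rfloor>)"
    define Q :: "int^'g^'h" where "Q = (\<chi> i j. - \<lfloor>q Z $ i $ j\<rfloor>)"
    let ?l = "lin (map_matrix of_int P) (map_matrix of_int Q)"
    have "Z + ?l \<in> F"
      by (simp add: F_def p_add q_add p_lin q_lin P_def Q_def) linarith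
    then show "\<exists>l. l \<in> ?L \<and> Z + l \<in> F" unfolding L_lin by force
  next
    fix l l' assume l: "l \<in> ?L \<and> Z + l \<in> F" and l': "l' \<in> ?L \<and> Z + l' \<in> F"
    obtain P Q where PQ: "l = lin (map_matrix of_int P) (map_matrix of_int Q)"
      using l unfolding L_lin by auto
    obtain P' Q' where PQ': "l' = lin (map_matrix of_int P') (map_matrix of_int Q')"
      using l' unfolding L_lin by auto
    have "P $ i $ j = P' $ i $ j \<and> Q $ i $ j = Q' $ i $ j" for i j
    proof -
      have "0 \<le> p Z $ i $ j + P $ i $ j" "p Z $ i $ j + P $ i $ j < 1"
        "0 \<le> q Z $ i $ j + Q $ i $ j" "q Z $ i $ j + Q $ i $ j < 1"
        using l by (auto simp: F_def p_add q_add p_lin q_lin PQ)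
      moreover have "0 \<le> p Z $ i $ j + P' $ i $ j" "p Z $ i $ j + P' $ i $ j < 1"
        "0 \<le> q Z $ i $ j + Q' $ i $ j" "q Z $ i $ j + Q' $ i $ j < 1"
        using l' by (auto simp: F_def p_add q_add p_lin q_lin PQ')
      ultimately show ?thesis by linarith
    qed
    then have "P = P'" "Q = Q'" by (simp_all add: vec_eq_iff)
    then show "l = l'" by (simp add: PQ PQ')
  qed
  define dv where "dv = distr (uniform_measure lborel F) (torus_borel \<Omega>) (torus_proj \<Omega>)"
  have sp: "space dv = torus \<Omega>" and st: "sets dv = sets (torus_borel \<Omega>)"
    by (simp_all add: dv_def)
  have vim: "torus_proj \<Omega> -` S \<in> sets borel" if "S \<in> sets (torus_borel \<Omega>)"
    for S :: "(complex^'g^'h) set set"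
    using measurable_sets[OF torus_proj_measurable that] by simp
  have em: "emeasure dv S = emeasure lborel (F \<inter> torus_proj \<Omega> -` S) / emeasure lborel F"
    if "S \<in> sets (torus_borel \<Omega>)" for S
    unfolding dv_def using that torus_proj_measurable vim[OF that] F_meas
    by (subst emeasure_distr) (auto simp: emeasure_uniform_measure measurable_def)
  have one: "emeasure dv (torus \<Omega>) = 1"
  proof -
    have "(torus \<Omega> :: (complex^'g^'h) set set) \<in> sets (torus_borel \<Omega>)" by (metis sets.top space_torus_borel)
    moreover have "torus_proj \<Omega> -` torus \<Omega> = (UNIV :: (complex^'g^'h) set)" by (auto simp: torus_proj_in_torus)
    ultimately show ?thesis using F_pos F_fin by (simp add: em ennreal_divide_self less_top)
  qed
  have "emeasure dv ((`) ((+) a) ` S) = emeasure dv S" if S: "S \<in> sets dv" for a S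
  proof -
    let ?S = "(`) ((+) a) ` S"
    have S': "S \<in> sets (torus_borel \<Omega>)" using S st by simp
    then have sub: "S \<subseteq> torus \<Omega>" using sets.sets_into_space by force
    have im: "?S = (`) ((+) (- a)) -` S \<inter> torus \<Omega>"
    proof (intro equalityI subsetI)
      fix C assume "C \<in> ?S"
      then obtain D where "D \<in> S" "C = (+) a ` D" by blast
      moreover obtain Z where "D = torus_proj \<Omega> Z" using \<open>D \<in> S\<close> sub torusE by blast
      ultimately show "C \<in> (`) ((+) (- a)) -` S \<inter> torus \<Omega>"
        by (simp add: translate_torus_proj torus_proj_in_torus del: uminus_add_conv_diff)
    next
      fix C assume C: "C \<in> (`) ((+) (- a)) -` S \<inter> torus \<Omega>"
      then obtain Z where "C = torus_proj \<Omega> Z" using torusE by blast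
      then have "C = (+) a ` ((+) (- a) ` C)" by (simp add: translate_torus_proj del: uminus_add_conv_diff)
      then show "C \<in> ?S" using C by blast
    qed
    have S_im: "?S \<in> sets (torus_borel \<Omega>)"
      unfolding im using measurable_sets[OF translate_measurable S'] by simp
    let ?T = "torus_proj \<Omega> -` S" and ?G = "{Z. Z + a \<in> F}"
    have "{Z. Z + a \<in> F \<inter> torus_proj \<Omega> -` ?S} = ?G \<inter> ?T"
      by (simp add: im translate_torus_proj torus_proj_in_torus del: uminus_add_conv_diff)
        (auto simp: add.commute)
    then have "emeasure lborel (F \<inter> torus_proj \<Omega> -` ?S) = emeasure lborel (?G \<inter> ?T)"
      using emeasure_lborel_shift[of "F \<inter> torus_proj \<Omega> -` ?S" a] F_meas vim[OF S_im] by simp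
    also have "\<dots> = emeasure lborel (F \<inter> ?T)"
    proof (rule fundamental_domains_emeasure_eq[where L = ?L])
      show "?G \<in> sets borel"
        using measurable_sets[of "\<lambda>Z. Z + a" borel borel F] F_meas by (simp add: vimage_def)
      show "\<exists>!l. l \<in> ?L \<and> Z + l \<in> ?G" for Z
        using F_fund[of "Z + a"] by (simp add: ac_simps)
      show "Z + l \<in> ?T \<longleftrightarrow> Z \<in> ?T" if "l \<in> ?L" for Z l
      proof -
        have "torus_proj \<Omega> Z = torus_proj \<Omega> (Z + l)" using that by (simp add: torus_proj_eq_iff)
        then show ?thesis by simp
      qed
    qed (use L_count period_lattice_minus F_meas F_fund vim[OF S'] in auto)
    finally show ?thesis by (simp add: em S' S_im)
  qed
  then have "normalized_invariant_volume \<Omega> dv"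
    unfolding normalized_invariant_volume_def using sp st one by blast
  then show ?thesis by blast
qed

end

theory Submission
  imports Defs
begin

text \<open>In the real coordinates \<open>Z = P + Q \<Omega>\<close> the function \<open>E\<^bsub>\<Omega>;A,B\<^esub>\<close> is the character
  \<open>exp (2\<pi>i \<Sum> (A\<^bsub>ij\<^esub> P\<^bsub>ij\<^esub> + B\<^bsub>ij\<^esub> Q\<^bsub>ij\<^esub>))\<close>. A nontrivial character takes the value \<open>-1\<close>, so its
  integral against an invariant measure equals its own negative; this gives orthonormality. For
  completeness, the entries of \<open>exp (2\<pi>i P)\<close> and \<open>exp (2\<pi>i Q)\<close> embed the torus as a compact subset of
  a Euclidean space, and by Stone--Weierstrass the trigonometric polynomials are uniformly dense in
  the continuous functions there. Truncated distance functions then approximate the indicators of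
  open sets, a Dynkin system argument the indicators of all Borel sets, and these span a dense
  subspace. Being exponentials of linear functions, the characters are eigenfunctions of every
  differential operator with constant coefficients.\<close>

section \<open>Square-integrable functions and Hilbert direct sums\<close>

text \<open>The volume element is an arbitrary measure satisfying
  \<open>normalized_invariant_volume\<close>, not a concrete integral over a fundamental cell.
  Integrals of characters can therefore be evaluated only from translation invariance and total mass
  1, and this dictates the argument with a translate on which the character is -1. The torus is a
  set of cosets that carries a sigma-algebra but no topology of its own. Continuity and compactness
  are borrowed from the lift to complex matrices and from the image of the embedding; the generators
  of the sigma-algebra are the families of cosets with open union. Elements of \<open>L2\<close> are
  classes whose representatives come from Hilbert choice. The analysis is done on functions, with
  squared errors instead of norms, and a transfer layer carries the results to classes. The direct
  sum is then a formal consequence of the basis property, valid over every measure: Fourier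
  coefficients give the components, and Pythagoras gives both convergence and uniqueness.\<close>

definition sq_integrable :: "'a measure \<Rightarrow> ('a \<Rightarrow> complex) \<Rightarrow> bool" where
  "sq_integrable M f \<longleftrightarrow> f \<in> borel_measurable M \<and> integrable M (\<lambda>x. (cmod (f x))\<^sup>2)"

lemma sq_integrable_measurable: "sq_integrable M f \<Longrightarrow> f \<in> borel_measurable M"
  by (simp add: sq_integrable_def)

lemma sq_integrable_square: "sq_integrable M f \<Longrightarrow> integrable M (\<lambda>x. (cmod (f x))\<^sup>2)"
  by (simp add: sq_integrable_def)

text \<open>Takes the place of the triangle inequality in \<open>L2\<close>, at the price of a
  factor 2, so that mean square errors can be added without square roots.\<close>

lemma cmod_add_square_le: "(cmod (a + b))\<^sup>2 \<le> 2 * (cmod a)\<^sup>2 + 2 * (cmod b)\<^sup>2"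
proof -
  have "(cmod (a + b))\<^sup>2 \<le> (cmod a + cmod b)\<^sup>2"
    by (intro power_mono norm_triangle_ineq) simp
  also have "\<dots> \<le> 2 * (cmod a)\<^sup>2 + 2 * (cmod b)\<^sup>2"
    using sum_squares_bound[of "cmod a" "cmod b"] by (simp add: power2_sum)
  finally show ?thesis .
qed

lemma sq_integrable_add:
  assumes "sq_integrable M f" "sq_integrable M g"
  shows "sq_integrable M (\<lambda>x. f x + g x)"
proof -
  have [measurable]: "f \<in> borel_measurable M" "g \<in> borel_measurable M"
    using assms by (simp_all add: sq_integrable_def)
  have "integrable M (\<lambda>x. 2 * (cmod (f x))\<^sup>2 + 2 * (cmod (g x))\<^sup>2)"
    using assms by (simp add: sq_integrable_def)
  then have "integrable M (\<lambda>x. (cmod (f x + g x))\<^sup>2)"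
    by (rule Bochner_Integration.integrable_bound) (use cmod_add_square_le in auto)
  then show ?thesis by (simp add: sq_integrable_def)
qed

lemma sq_integrable_scale:
  "sq_integrable M f \<Longrightarrow> sq_integrable M (\<lambda>x. c * f x)"
  by (auto simp: sq_integrable_def norm_mult power_mult_distrib)

lemma sq_integrable_diff:
  assumes "sq_integrable M f" "sq_integrable M g"
  shows "sq_integrable M (\<lambda>x. f x - g x)"
  using sq_integrable_add[OF assms(1) sq_integrable_scale[OF assms(2), of "-1"]] by simp

lemma sq_integrable_sum:
  "(\<And>j. j \<in> J \<Longrightarrow> sq_integrable M (f j)) \<Longrightarrow> sq_integrable M (\<lambda>x. \<Sum>j\<in>J. f j x)"
proof (induction J rule: infinite_finite_induct)
  case (insert j J)
  then show ?case by (simp add: sq_integrable_add)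
qed (simp_all add: sq_integrable_def)

lemma sq_integrable_lincomb:
  "(\<And>j. j \<in> J \<Longrightarrow> sq_integrable M (f j)) \<Longrightarrow> sq_integrable M (\<lambda>x. \<Sum>j\<in>J. c j * f j x)"
  by (intro sq_integrable_sum sq_integrable_scale)

lemma (in finite_measure) sq_integrable_bounded:
  assumes [measurable]: "f \<in> borel_measurable M" and "\<And>x. x \<in> space M \<Longrightarrow> cmod (f x) \<le> C"
  shows "sq_integrable M f"
proof -
  have "integrable M (\<lambda>x. (cmod (f x))\<^sup>2)"
    by (rule integrable_const_bound[where B = "C\<^sup>2"]) (use assms(2) in \<open>auto intro!: power_mono\<close>)
  then show ?thesis by (simp add: sq_integrable_def)
qed

lemma integrable_mult_cnj:
  assumes "sq_integrable M f" "sq_integrable M g"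
  shows "integrable M (\<lambda>x. f x * cnj (g x))"
proof -
  have [measurable]: "f \<in> borel_measurable M" "g \<in> borel_measurable M"
    using assms by (simp_all add: sq_integrable_def)
  have cnj_meas: "cnj \<in> borel_measurable borel"
    by (intro borel_measurable_continuous_onI continuous_intros)
  have [measurable]: "(\<lambda>x. cnj (g x)) \<in> borel_measurable M"
    by (rule measurable_compose[OF _ cnj_meas]) simp
  \<comment> \<open>Twice the product of two moduli is at most the sum of their squares, which gives
    an integrable majorant.\<close>
  have "cmod (f x * cnj (g x)) \<le> (cmod (f x))\<^sup>2 + (cmod (g x))\<^sup>2" for x
    using sum_squares_bound[of "cmod (f x)" "cmod (g x)"]
      mult_nonneg_nonneg[OF norm_ge_zero[of "f x"] norm_ge_zero[of "g x"]]
    unfolding norm_mult complex_mod_cnj by linarith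
  then show ?thesis
    by (intro Bochner_Integration.integrable_bound[OF Bochner_Integration.integrable_add[OF
            sq_integrable_square[OF assms(1)] sq_integrable_square[OF assms(2)]]])
      (auto simp del: norm_mult)
qed

lemma integral_mult_cnj_swap:
  "(LINT x|M. g x * cnj (f x)) = cnj (LINT x|M. f x * cnj (g x))"
proof -
  have "(LINT x|M. g x * cnj (f x)) = (LINT x|M. cnj (f x * cnj (g x)))"
    by (simp add: mult.commute)
  then show ?thesis by (simp only: Bochner_Integration.integral_cnj)
qed

text \<open>Pythagoras. Both the best approximation by Fourier coefficients and the uniqueness of the
  coefficients of a convergent expansion are read off from the last sum.\<close>

lemma orthonormal_error_decomposition:
  fixes f :: "'a \<Rightarrow> complex" and e :: "'i \<Rightarrow> 'a \<Rightarrow> complex"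
  assumes J: "finite J" and f: "sq_integrable M f" and e: "\<And>j. j \<in> J \<Longrightarrow> sq_integrable M (e j)"
    and orth: "\<And>i j. i \<in> J \<Longrightarrow> j \<in> J \<Longrightarrow> (LINT x|M. e i x * cnj (e j x)) = (if i = j then 1 else 0)"
  defines "a \<equiv> \<lambda>j. LINT x|M. f x * cnj (e j x)"
  shows "(LINT x|M. (cmod (f x - (\<Sum>j\<in>J. c j * e j x)))\<^sup>2) =
    (LINT x|M. (cmod (f x))\<^sup>2) - (\<Sum>j\<in>J. (cmod (a j))\<^sup>2) + (\<Sum>j\<in>J. (cmod (c j - a j))\<^sup>2)"
    (is "?l = ?r")
proof -
  note int = integrable_mult_cnj[OF f f] integrable_mult_cnj[OF f e] integrable_mult_cnj[OF e f]
    integrable_mult_cnj[OF e e]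
  have sq: "complex_of_real ((cmod z)\<^sup>2) = z * cnj z" for z
    by (simp only: complex_norm_square)
  \<comment> \<open>The computation is carried out over the complex numbers, where |z|^2 = z * cnj z
    turns the squared error into a sesquilinear expression.\<close>
  have "complex_of_real ?l =
      (LINT x|M. (f x - (\<Sum>j\<in>J. c j * e j x)) * cnj (f x - (\<Sum>j\<in>J. c j * e j x)))"
    by (subst integral_complex_of_real[symmetric]) (simp only: sq)
  also have "\<dots> = (LINT x|M. f x * cnj (f x)
      - (\<Sum>j\<in>J. cnj (c j) * (f x * cnj (e j x)))
      - (\<Sum>j\<in>J. c j * (e j x * cnj (f x)))
      + (\<Sum>i\<in>J. \<Sum>j\<in>J. c i * cnj (c j) * (e i x * cnj (e j x))))"
    by (rule Bochner_Integration.integral_cong[OF refl])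
      (simp add: algebra_simps sum_distrib_left sum_distrib_right, subst sum.swap, simp)
  also have "\<dots> = (LINT x|M. f x * cnj (f x))
      - (\<Sum>j\<in>J. cnj (c j) * a j) - (\<Sum>j\<in>J. c j * cnj (a j))
      + (\<Sum>i\<in>J. \<Sum>j\<in>J. c i * cnj (c j) * (if i = j then 1 else 0))"
  proof -
    have 1: "integrable M (\<lambda>x. \<Sum>j\<in>J. cnj (c j) * (f x * cnj (e j x)))"
      "integrable M (\<lambda>x. \<Sum>j\<in>J. c j * (e j x * cnj (f x)))"
      "integrable M (\<lambda>x. \<Sum>i\<in>J. \<Sum>j\<in>J. c i * cnj (c j) * (e i x * cnj (e j x)))"
      by (intro Bochner_Integration.integrable_sum integrable_mult_right int; assumption)+
    have 2: "(LINT x|M. (\<Sum>j\<in>J. cnj (c j) * (f x * cnj (e j x)))) = (\<Sum>j\<in>J. cnj (c j) * a j)"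
      by (subst Bochner_Integration.integral_sum) (auto simp: a_def intro!: int)
    have 3: "(LINT x|M. (\<Sum>j\<in>J. c j * (e j x * cnj (f x)))) = (\<Sum>j\<in>J. c j * cnj (a j))"
      by (subst Bochner_Integration.integral_sum)
        (auto simp: a_def integral_mult_cnj_swap[of M _ f] intro!: int)
    have 4: "(LINT x|M. (\<Sum>i\<in>J. \<Sum>j\<in>J. c i * cnj (c j) * (e i x * cnj (e j x)))) =
        (\<Sum>i\<in>J. \<Sum>j\<in>J. c i * cnj (c j) * (if i = j then 1 else 0))"
    proof (subst Bochner_Integration.integral_sum)
      show "integrable M (\<lambda>x. \<Sum>j\<in>J. c i * cnj (c j) * (e i x * cnj (e j x)))" if "i \<in> J" for i
        by (intro Bochner_Integration.integrable_sum integrable_mult_right int that)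
      have "(LINT x|M. (\<Sum>j\<in>J. c i * cnj (c j) * (e i x * cnj (e j x)))) =
        (\<Sum>j\<in>J. c i * cnj (c j) * (if i = j then 1 else 0))" if "i \<in> J" for i
        by (subst Bochner_Integration.integral_sum)
          (use that in \<open>auto intro!: int sum.cong simp: orth\<close>)
      then show "(\<Sum>i\<in>J. LINT x|M. (\<Sum>j\<in>J. c i * cnj (c j) * (e i x * cnj (e j x)))) =
        (\<Sum>i\<in>J. \<Sum>j\<in>J. c i * cnj (c j) * (if i = j then 1 else 0))" by (intro sum.cong) auto
    qed
    show ?thesis
      using 1 int(1) by (simp add: 2 3 4)
  qed
  \<comment> \<open>Orthonormality collapses the double sum to its diagonal. Then complete the
    square in each index: |c|^2 - cnj c * a - c * cnj a = |c - a|^2 - |a|^2.\<close>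
  also have "\<dots> = (LINT x|M. f x * cnj (f x))
      - (\<Sum>j\<in>J. a j * cnj (a j)) + (\<Sum>j\<in>J. (c j - a j) * cnj (c j - a j))"
    using J by (simp add: sum.delta' algebra_simps sum.distrib sum_subtractf if_distrib[of "(*) _"]
        cong: if_cong)
  also have "\<dots> = complex_of_real ?r"
    by (simp only: of_real_add of_real_diff of_real_sum sq integral_complex_of_real[symmetric])
  finally show ?thesis by (simp only: of_real_eq_iff)
qed

section \<open>Classes modulo null sets and their representatives\<close>

lemma ae_class_eqI: "AE x in M. f x = g x \<Longrightarrow> ae_class M f = ae_class M g"
proof -
  assume fg: "AE x in M. f x = g x"
  have "(AE x in M. h x = f x) \<longleftrightarrow> (AE x in M. h x = g x)" for h
    by (rule eventually_subst) (use fg in eventually_elim, simp)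
  then show ?thesis by (simp add: ae_class_def)
qed

text \<open>All that is known of a chosen representative is that it lies in the class. Measurability
  of \<open>f\<close> puts \<open>f\<close> itself there, so the choice is made from a nonempty
  set.\<close>

lemma ae_rep_ae_class:
  assumes "f \<in> borel_measurable M"
  shows "ae_rep (ae_class M f) \<in> borel_measurable M" "AE x in M. ae_rep (ae_class M f) x = f x"
proof -
  have "f \<in> ae_class M f" using assms by (simp add: ae_class_def)
  then have "ae_rep (ae_class M f) \<in> ae_class M f" unfolding ae_rep_def by (rule someI[where P = "\<lambda>h. h \<in> ae_class M f"])
  then show "ae_rep (ae_class M f) \<in> borel_measurable M" "AE x in M. ae_rep (ae_class M f) x = f x"
    by (simp_all add: ae_class_def)
qed

lemma L2_iff: "F \<in> L2 M \<longleftrightarrow> (\<exists>f. sq_integrable M f \<and> F = ae_class M f)"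
  by (auto simp: L2_def sq_integrable_def)

lemma ae_class_in_L2: "sq_integrable M f \<Longrightarrow> ae_class M f \<in> L2 M"
  by (auto simp: L2_iff)

lemma L2_ae_rep:
  assumes "F \<in> L2 M"
  shows "sq_integrable M (ae_rep F)" "ae_class M (ae_rep F) = F"
proof -
  obtain f where f: "sq_integrable M f" "F = ae_class M f"
    using assms by (auto simp: L2_iff)
  note r = ae_rep_ae_class[OF sq_integrable_measurable[OF f(1)], folded f(2)]
  have "integrable M (\<lambda>x. (cmod (ae_rep F x))\<^sup>2)"
    by (rule integrable_cong_AE_imp[OF sq_integrable_square[OF f(1)]])
      (use r in \<open>auto elim: eventually_mono\<close>)
  then show "sq_integrable M (ae_rep F)" using r by (simp add: sq_integrable_def)
  show "ae_class M (ae_rep F) = F" unfolding f(2) by (rule ae_class_eqI) (use r f(2) in simp)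
qed

lemma L2_inner_ae_class:
  assumes "f \<in> borel_measurable M" "g \<in> borel_measurable M"
  shows "L2_inner M (ae_class M f) (ae_class M g) = (LINT x|M. f x * cnj (g x))"
proof -
  note r = ae_rep_ae_class[OF assms(1)] ae_rep_ae_class[OF assms(2)]
  have cnj_meas: "cnj \<in> borel_measurable borel"
    by (intro borel_measurable_continuous_onI continuous_intros)
  have [measurable]: "(\<lambda>x. cnj (h x)) \<in> borel_measurable M" if "h \<in> borel_measurable M" for h
    by (rule measurable_compose[OF that cnj_meas])
  show ?thesis
    unfolding L2_inner_def
  proof (rule integral_cong_AE)
    show "AE x in M. ae_rep (ae_class M f) x * cnj (ae_rep (ae_class M g) x) = f x * cnj (g x)"
      using r(2,4) by eventually_elim simp
  qed (use assms r in auto)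
qed

lemma L2_dist_ae_class:
  assumes "f \<in> borel_measurable M" "g \<in> borel_measurable M"
  shows "L2_dist M (ae_class M f) (ae_class M g) = sqrt (LINT x|M. (cmod (f x - g x))\<^sup>2)"
proof -
  note r = ae_rep_ae_class[OF assms(1)] ae_rep_ae_class[OF assms(2)]
  have "(LINT x|M. (cmod (ae_rep (ae_class M f) x - ae_rep (ae_class M g) x))\<^sup>2) =
      (LINT x|M. (cmod (f x - g x))\<^sup>2)"
  proof (rule integral_cong_AE)
    show "AE x in M. (cmod (ae_rep (ae_class M f) x - ae_rep (ae_class M g) x))\<^sup>2 =
        (cmod (f x - g x))\<^sup>2"
      using r(2,4) by eventually_elim simp
  qed (use assms r in auto)
  then show ?thesis by (simp add: L2_dist_def)
qed

lemma L2_lincomb_ae_class: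
  assumes "finite J" "\<And>j. j \<in> J \<Longrightarrow> f j \<in> borel_measurable M"
    and F: "\<And>j. j \<in> J \<Longrightarrow> F j = ae_class M (f j)"
  shows "L2_lincomb M J c F = ae_class M (\<lambda>x. \<Sum>j\<in>J. c j * f j x)"
  unfolding L2_lincomb_def
proof (rule ae_class_eqI)
  \<comment> \<open>Each representative differs from its function on a null set; finitely many null
    sets have a null union.\<close>
  have "AE x in M. \<forall>j\<in>J. ae_rep (F j) x = f j x"
    using assms by (intro AE_finite_allI) (auto intro: ae_rep_ae_class)
  then show "AE x in M. (\<Sum>j\<in>J. c j * ae_rep (F j) x) = (\<Sum>j\<in>J. c j * f j x)"
    by eventually_elim simp
qed

lemma L2_line_ae_class:
  assumes "f \<in> borel_measurable M"
  shows "L2_line M (ae_class M f) = {ae_class M (\<lambda>x. c * f x) | c. True}"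
proof -
  have "ae_class M (\<lambda>x. c * ae_rep (ae_class M f) x) = ae_class M (\<lambda>x. c * f x)" for c
    by (rule ae_class_eqI) (use ae_rep_ae_class(2)[OF assms] in \<open>auto elim: eventually_mono\<close>)
  then show ?thesis by (simp add: L2_line_def)
qed

lemma AE_eq_if_square_error_0:
  assumes "sq_integrable M f" "sq_integrable M g" "(LINT x|M. (cmod (f x - g x))\<^sup>2) \<le> 0"
  shows "AE x in M. f x = g x"
proof -
  have i: "integrable M (\<lambda>x. (cmod (f x - g x))\<^sup>2)"
    using sq_integrable_diff[OF assms(1,2)] by (simp add: sq_integrable_def)
  have "(LINT x|M. (cmod (f x - g x))\<^sup>2) = 0"
    using assms(3) by (intro antisym) auto
  then have "AE x in M. (cmod (f x - g x))\<^sup>2 = 0"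
    using integral_nonneg_eq_0_iff_AE[OF i] by simp
  then show ?thesis by (auto elim: eventually_mono)
qed

section \<open>Orthonormal bases and the direct sums they induce\<close>

text \<open>Translates the basis property into the form that can be verified by analysis: functions
  in place of classes and mean square errors in place of distances.\<close>

lemma L2_complete_orthonormal_basis_ae_class:
  fixes e :: "'i \<Rightarrow> 'a \<Rightarrow> complex"
  assumes e: "\<And>i. i \<in> I \<Longrightarrow> sq_integrable M (e i)"
  shows "L2_complete_orthonormal_basis M I (\<lambda>i. ae_class M (e i)) \<longleftrightarrow>
    (\<forall>i\<in>I. \<forall>j\<in>I. (LINT x|M. e i x * cnj (e j x)) = (if i = j then 1 else 0)) \<and>
    (\<forall>f. sq_integrable M f \<longrightarrow> (\<forall>\<epsilon>>0. \<exists>J c. finite J \<and> J \<subseteq> I \<and>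
       (LINT x|M. (cmod (f x - (\<Sum>j\<in>J. c j * e j x)))\<^sup>2) < \<epsilon>))"
proof -
  have em: "e i \<in> borel_measurable M" if "i \<in> I" for i
    using e[OF that] by (rule sq_integrable_measurable)
  have dist: "L2_dist M (L2_lincomb M J c (\<lambda>i. ae_class M (e i))) (ae_class M f) =
      sqrt (LINT x|M. (cmod (f x - (\<Sum>j\<in>J. c j * e j x)))\<^sup>2)"
    if "finite J" "J \<subseteq> I" "sq_integrable M f" for J c f
  proof -
    have "L2_lincomb M J c (\<lambda>i. ae_class M (e i)) = ae_class M (\<lambda>x. \<Sum>j\<in>J. c j * e j x)"
      using that em by (intro L2_lincomb_ae_class) auto
    moreover have "(\<lambda>x. \<Sum>j\<in>J. c j * e j x) \<in> borel_measurable M"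
      using that e by (intro sq_integrable_measurable sq_integrable_lincomb) auto
    ultimately show ?thesis
      using L2_dist_ae_class[OF _ sq_integrable_measurable[OF that(3)]]
      by (simp add: norm_minus_commute)
  qed
  have 1: "(\<forall>F\<in>L2 M. \<forall>\<epsilon>>0. \<exists>J c. finite J \<and> J \<subseteq> I \<and>
        L2_dist M (L2_lincomb M J c (\<lambda>i. ae_class M (e i))) F < \<epsilon>) \<longleftrightarrow>
      (\<forall>f. sq_integrable M f \<longrightarrow> (\<forall>\<epsilon>>0. \<exists>J c. finite J \<and> J \<subseteq> I \<and>
        sqrt (LINT x|M. (cmod (f x - (\<Sum>j\<in>J. c j * e j x)))\<^sup>2) < \<epsilon>))"
  proof -
    have "(\<forall>F\<in>L2 M. P F) \<longleftrightarrow> (\<forall>f. sq_integrable M f \<longrightarrow> P (ae_class M f))" for P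
      by (metis L2_iff)
    then show ?thesis by (simp add: dist cong: conj_cong)
  qed
  also have "\<dots> \<longleftrightarrow> (\<forall>f. sq_integrable M f \<longrightarrow> (\<forall>\<epsilon>>0. \<exists>J c. finite J \<and> J \<subseteq> I \<and>
        (LINT x|M. (cmod (f x - (\<Sum>j\<in>J. c j * e j x)))\<^sup>2) < \<epsilon>))"
  proof -
    \<comment> \<open>The square root disappears because the tolerance is arbitrary: use sqrt
      \<epsilon> in one direction and \<epsilon>^2 in the other.\<close>
    have "(\<forall>\<epsilon>>0. \<exists>J c. P J \<and> sqrt (N J c) < \<epsilon>) \<longleftrightarrow> (\<forall>\<epsilon>>0. \<exists>J c. P J \<and> N J c < \<epsilon>)"
      for P :: "'i set \<Rightarrow> bool" and N :: "'i set \<Rightarrow> ('i \<Rightarrow> complex) \<Rightarrow> real"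
    proof safe
      fix \<epsilon> :: real assume *: "\<forall>\<epsilon>>0. \<exists>J c. P J \<and> sqrt (N J c) < \<epsilon>" and "\<epsilon> > 0"
      then obtain J c where "P J" "sqrt (N J c) < sqrt \<epsilon>" by (meson real_sqrt_gt_0_iff)
      then show "\<exists>J c. P J \<and> N J c < \<epsilon>" by auto
    next
      fix \<epsilon> :: real assume *: "\<forall>\<epsilon>>0. \<exists>J c. P J \<and> N J c < \<epsilon>" and "\<epsilon> > 0"
      then obtain J c where Jc: "P J" "N J c < \<epsilon>\<^sup>2" by (meson zero_less_power)
      then have "sqrt (N J c) < \<epsilon>" using real_sqrt_less_mono[OF Jc(2)] \<open>\<epsilon> > 0\<close> by simp
      then show "\<exists>J c. P J \<and> sqrt (N J c) < \<epsilon>" using Jc by blast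
    qed
    from this[of "\<lambda>J. finite J \<and> J \<subseteq> I"] show ?thesis by (simp add: conj_assoc)
  qed
  finally show ?thesis
    unfolding L2_complete_orthonormal_basis_def using e
    by (auto simp: L2_inner_ae_class em L2_iff)
qed

text \<open>The squared error of any finite expansion is the error with Fourier coefficients plus
  the squared deviations from those coefficients. Density drives the first part to 0 along the
  finite index sets, which gives existence; convergence of an expansion drives the second part to 0,
  which gives uniqueness.\<close>

theorem L2_hilbert_direct_sum_if_basis:
  assumes basis: "L2_complete_orthonormal_basis M I E"
  shows "L2_hilbert_direct_sum M I (\<lambda>i. L2_line M (E i))"
proof -
  define e where "e i = ae_rep (E i)" for i
  have E: "E i \<in> L2 M" if "i \<in> I" for i
    using basis that by (simp add: L2_complete_orthonormal_basis_def)
  have e: "sq_integrable M (e i)" if "i \<in> I" for i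
    using L2_ae_rep(1)[OF E[OF that]] by (simp add: e_def)
  have em: "e i \<in> borel_measurable M" if "i \<in> I" for i
    using e[OF that] by (rule sq_integrable_measurable)
  have Ee: "E i = ae_class M (e i)" if "i \<in> I" for i
    using L2_ae_rep(2)[OF E[OF that]] by (simp add: e_def)
  have "L2_lincomb M J c E = L2_lincomb M J c (\<lambda>i. ae_class M (e i))" if "finite J" "J \<subseteq> I" for J c
    using that Ee em
    by (subst (1 2) L2_lincomb_ae_class[where f = e]) auto
  then have "L2_complete_orthonormal_basis M I (\<lambda>i. ae_class M (e i))"
    using basis Ee unfolding L2_complete_orthonormal_basis_def by (metis (no_types, lifting))
  note b = iffD1[OF L2_complete_orthonormal_basis_ae_class[of I M e, OF e] this]
  have orth: "(LINT x|M. e i x * cnj (e j x)) = (if i = j then 1 else 0)" if "i \<in> I" "j \<in> I" for i j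
    using b that by blast
  have dense: "\<exists>J c. finite J \<and> J \<subseteq> I \<and> (LINT x|M. (cmod (f x - (\<Sum>j\<in>J. c j * e j x)))\<^sup>2) < \<epsilon>"
    if "sq_integrable M f" "\<epsilon> > 0" for f \<epsilon>
    using b that by blast
  have line: "L2_line M (E i) = {ae_class M (\<lambda>x. c * e i x) | c. True}" if "i \<in> I" for i
    using that by (simp add: Ee L2_line_ae_class em)
  note decomp = orthonormal_error_decomposition[OF _ _ e orth]
  define a where "a f i = (LINT x|M. f x * cnj (e i x))" for f i
  \<comment> \<open>Compare the decomposition for \<open>c\<close> with the one for the Fourier
    coefficients, where the sum of squared deviations vanishes.\<close>
  have best: "(LINT x|M. (cmod (f x - (\<Sum>j\<in>J. c j * e j x)))\<^sup>2) =
      (LINT x|M. (cmod (f x - (\<Sum>j\<in>J. a f j * e j x)))\<^sup>2) + (\<Sum>j\<in>J. (cmod (c j - a f j))\<^sup>2)"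
    if "finite J" "J \<subseteq> I" "sq_integrable M f" for f J c
    using decomp[of J f c] decomp[of J f "a f"] that by (simp add: subset_iff a_def)
  have dist: "L2_dist M (L2_lincomb M J (\<lambda>_. 1) v) (ae_class M f) =
      sqrt (LINT x|M. (cmod (f x - (\<Sum>j\<in>J. c j * e j x)))\<^sup>2)"
    if "finite J" "J \<subseteq> I" "sq_integrable M f" "\<And>j. j \<in> J \<Longrightarrow> v j = ae_class M (\<lambda>x. c j * e j x)" for J c f v
  proof -
    have "L2_lincomb M J (\<lambda>_. 1) v = ae_class M (\<lambda>x. \<Sum>j\<in>J. 1 * (c j * e j x))"
      using that em by (intro L2_lincomb_ae_class) (auto simp: subset_iff)
    moreover have "(\<lambda>x. \<Sum>j\<in>J. c j * e j x) \<in> borel_measurable M"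
      using that e by (intro sq_integrable_measurable sq_integrable_lincomb) auto
    ultimately show ?thesis
      using L2_dist_ae_class[OF _ sq_integrable_measurable[OF that(3)]]
      by (simp add: norm_minus_commute)
  qed

  have closed: "L2_closed_subspace M (L2_line M (E i))" if i: "i \<in> I" for i
    unfolding L2_closed_subspace_def
  proof (intro conjI allI impI ballI)
    show "L2_line M (E i) \<subseteq> L2 M"
      unfolding line[OF i] using ae_class_in_L2[OF sq_integrable_scale[OF e[OF i]]] by auto
  next
    fix J :: "nat set" and c F assume J: "finite J \<and> (\<forall>j\<in>J. F j \<in> L2_line M (E i))"
    then have "\<forall>j\<in>J. \<exists>d. F j = ae_class M (\<lambda>x. d * e i x)" unfolding line[OF i] by blast
    then obtain d where d: "\<And>j. j \<in> J \<Longrightarrow> F j = ae_class M (\<lambda>x. d j * e i x)" by metis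
    have "L2_lincomb M J c F = ae_class M (\<lambda>x. \<Sum>j\<in>J. c j * (d j * e i x))"
      using J d em[OF i] by (intro L2_lincomb_ae_class) auto
    also have "\<dots> = ae_class M (\<lambda>x. (\<Sum>j\<in>J. c j * d j) * e i x)"
      by (simp add: sum_distrib_right mult.assoc)
    finally show "L2_lincomb M J c F \<in> L2_line M (E i)" unfolding line[OF i] by blast
  next
    fix S :: "nat \<Rightarrow> _" and F
    assume F: "F \<in> L2 M" and S: "(\<forall>n. S n \<in> L2_line M (E i)) \<and> (\<lambda>n. L2_dist M (S n) F) \<longlonglongrightarrow> 0"
    then obtain f where f: "sq_integrable M f" "F = ae_class M f" by (auto simp: L2_iff)
    have "\<forall>n. \<exists>d. S n = ae_class M (\<lambda>x. d * e i x)" using S unfolding line[OF i] by blast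
    then obtain d where d: "\<And>n. S n = ae_class M (\<lambda>x. d n * e i x)" by metis
    \<comment> \<open>Among the multiples of \<open>e i\<close> the Fourier coefficient has the
      least error. If multiples converge to \<open>F\<close>, this least error is 0, so
      \<open>F\<close> is itself a multiple.\<close>
    have le: "sqrt (LINT x|M. (cmod (f x - a f i * e i x))\<^sup>2) \<le> L2_dist M (S n) F" for n
    proof -
      have "L2_dist M (S n) F = sqrt (LINT x|M. (cmod (f x - d n * e i x))\<^sup>2)"
        unfolding d f(2) using em[OF i] sq_integrable_measurable[OF f(1)]
        by (subst L2_dist_ae_class) (auto simp: norm_minus_commute)
      then show ?thesis
        using best[of "{i}" f "\<lambda>_. d n"] i f(1) by simp
    qed
    have "sqrt (LINT x|M. (cmod (f x - a f i * e i x))\<^sup>2) \<le> 0"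
      by (rule LIMSEQ_le_const[of "\<lambda>n. L2_dist M (S n) F"]) (use S le in auto)
    then have "(LINT x|M. (cmod (f x - a f i * e i x))\<^sup>2) \<le> 0" by simp
    then have "AE x in M. f x = a f i * e i x"
      using AE_eq_if_square_error_0[OF f(1) sq_integrable_scale[OF e[OF i]]] by blast
    then have "F = ae_class M (\<lambda>x. a f i * e i x)" unfolding f(2) by (rule ae_class_eqI)
    then show "F \<in> L2_line M (E i)" unfolding line[OF i] by blast
  qed
  have orthogonal: "L2_inner M F G = 0"
    if ij: "i \<in> I" "j \<in> I" "i \<noteq> j" and FG: "F \<in> L2_line M (E i)" "G \<in> L2_line M (E j)" for i j F G
  proof -
    obtain c d where "F = ae_class M (\<lambda>x. c * e i x)" "G = ae_class M (\<lambda>x. d * e j x)"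
      using FG unfolding line[OF ij(1)] line[OF ij(2)] by blast
    then have "L2_inner M F G = (LINT x|M. (c * e i x) * cnj (d * e j x))"
      using em ij by (simp add: L2_inner_ae_class)
    also have "\<dots> = (LINT x|M. (c * cnj d) * (e i x * cnj (e j x)))"
      by (simp add: mult_ac)
    also have "\<dots> = 0" using orth[OF ij(1,2)] ij(3) by simp
    finally show ?thesis .
  qed
  have unique: "\<exists>!v. v \<in> Pi\<^sub>E I (\<lambda>i. L2_line M (E i)) \<and>
      ((\<lambda>J. L2_dist M (L2_lincomb M J (\<lambda>_. 1) v) F) \<longlongrightarrow> 0) (finite_subsets_at_top I)"
    if F: "F \<in> L2 M" for F
  proof -
    obtain f where f: "sq_integrable M f" "F = ae_class M f" using F by (auto simp: L2_iff)
    \<comment> \<open>The restriction gives \<open>v\<close> the default value outside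
      \<open>I\<close> that \<open>Pi\<^sub>E\<close> demands; otherwise it could not be the unique
      family.\<close>
    define v where "v = restrict (\<lambda>i. ae_class M (\<lambda>x. a f i * e i x)) I"
    show ?thesis
    proof (rule ex1I[of _ v], rule conjI)
      show "v \<in> Pi\<^sub>E I (\<lambda>i. L2_line M (E i))"
        by (auto simp: v_def line)
      show "((\<lambda>J. L2_dist M (L2_lincomb M J (\<lambda>_. 1) v) F) \<longlongrightarrow> 0) (finite_subsets_at_top I)"
      proof (rule tendstoI)
        fix \<epsilon> :: real assume "\<epsilon> > 0"
        then obtain J0 c where J0: "finite J0" "J0 \<subseteq> I"
          and c: "(LINT x|M. (cmod (f x - (\<Sum>j\<in>J0. c j * e j x)))\<^sup>2) < \<epsilon>\<^sup>2"
          using dense[OF f(1), of "\<epsilon>\<^sup>2"] by auto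
        have "dist (L2_dist M (L2_lincomb M J (\<lambda>_. 1) v) F) 0 < \<epsilon>"
          if J: "finite J" "J0 \<subseteq> J" "J \<subseteq> I" for J
        proof -
          \<comment> \<open>Extension by zero turns an approximant over \<open>J0\<close> into one
            over every larger \<open>J\<close>, so the optimal error over \<open>J\<close> is at
            most the error already attained over \<open>J0\<close>.\<close>
          define c' where "c' j = (if j \<in> J0 then c j else 0)" for j
          have "(\<Sum>j\<in>J. c' j * e j x) = (\<Sum>j\<in>J0. c j * e j x)" for x
            by (rule sum.mono_neutral_cong_right) (use J in \<open>auto simp: c'_def\<close>)
          then have "(LINT x|M. (cmod (f x - (\<Sum>j\<in>J. a f j * e j x)))\<^sup>2) < \<epsilon>\<^sup>2"
            using best[OF J(1,3) f(1), of c'] c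
              sum_nonneg[of J "\<lambda>j. (cmod (c' j - a f j))\<^sup>2"] by simp
          moreover have "L2_dist M (L2_lincomb M J (\<lambda>_. 1) v) F =
              sqrt (LINT x|M. (cmod (f x - (\<Sum>j\<in>J. a f j * e j x)))\<^sup>2)"
            unfolding f(2) by (rule dist) (use J f in \<open>auto simp: v_def\<close>)
          moreover have "sqrt y < \<epsilon>" if "y < \<epsilon>\<^sup>2" for y
            using real_sqrt_less_mono[OF that] \<open>\<epsilon> > 0\<close> by simp
          ultimately show ?thesis by (simp add: dist_real_def)
        qed
        then show "\<forall>\<^sub>F J in finite_subsets_at_top I. dist (L2_dist M (L2_lincomb M J (\<lambda>_. 1) v) F) 0 < \<epsilon>"
          unfolding eventually_finite_subsets_at_top using J0 by blast
      qed
    next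
      fix w assume w: "w \<in> Pi\<^sub>E I (\<lambda>i. L2_line M (E i)) \<and>
        ((\<lambda>J. L2_dist M (L2_lincomb M J (\<lambda>_. 1) w) F) \<longlongrightarrow> 0) (finite_subsets_at_top I)"
      then have "\<forall>i\<in>I. \<exists>d. w i = ae_class M (\<lambda>x. d * e i x)" using line by blast
      then obtain d where d: "\<And>i. i \<in> I \<Longrightarrow> w i = ae_class M (\<lambda>x. d i * e i x)" by metis
      have "d i = a f i" if i: "i \<in> I" for i
      proof -
        \<comment> \<open>For every \<open>J\<close> containing \<open>i\<close> the deviation of
          this single coefficient bounds the distance from below, so it is at most the limit of the
          distances, which is 0.\<close>
        have "cmod (d i - a f i) \<le> L2_dist M (L2_lincomb M J (\<lambda>_. 1) w) F"
          if J: "finite J" "{i} \<subseteq> J" "J \<subseteq> I" for J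
        proof -
          have L: "L2_dist M (L2_lincomb M J (\<lambda>_. 1) w) F =
              sqrt (LINT x|M. (cmod (f x - (\<Sum>j\<in>J. d j * e j x)))\<^sup>2)"
            unfolding f(2) by (rule dist) (use J f d in auto)
          moreover have "(cmod (d i - a f i))\<^sup>2 \<le> (\<Sum>j\<in>J. (cmod (d j - a f j))\<^sup>2)"
            using J by (intro member_le_sum) auto
          moreover have "0 \<le> (LINT x|M. (cmod (f x - (\<Sum>j\<in>J. a f j * e j x)))\<^sup>2)" by simp
          ultimately have "(cmod (d i - a f i))\<^sup>2 \<le> (LINT x|M. (cmod (f x - (\<Sum>j\<in>J. d j * e j x)))\<^sup>2)"
            using best[OF J(1,3) f(1), of d] by linarith
          then show ?thesis unfolding L by (rule real_le_rsqrt)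
        qed
        then have ev: "\<forall>\<^sub>F J in finite_subsets_at_top I.
            cmod (d i - a f i) \<le> L2_dist M (L2_lincomb M J (\<lambda>_. 1) w) F"
          unfolding eventually_finite_subsets_at_top using i by (intro exI[of _ "{i}"]) auto
        have "cmod (d i - a f i) \<le> 0"
          by (rule tendsto_lowerbound[OF _ ev]) (use w in auto)
        then show ?thesis by simp
      qed
      then show "w = v"
        using w d by (auto simp: v_def PiE_def extensional_def fun_eq_iff)
    qed
  qed
  show ?thesis
    unfolding L2_hilbert_direct_sum_def
    by (intro conjI ballI impI) (fact closed, rule orthogonal, assumption+, rule unique)
qed

section \<open>Mean square approximation\<close>

definition mean_square_approximable :: "'a measure \<Rightarrow> ('a \<Rightarrow> complex) set \<Rightarrow> ('a \<Rightarrow> complex) \<Rightarrow> bool" where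
  "mean_square_approximable M T f \<longleftrightarrow> (\<forall>\<epsilon>>0. \<exists>t\<in>T. (LINT x|M. (cmod (f x - t x))\<^sup>2) < \<epsilon>)"

lemma integral_cmod_add_square_le:
  assumes "sq_integrable M f" "sq_integrable M g"
  shows "(LINT x|M. (cmod (f x + g x))\<^sup>2) \<le>
    2 * (LINT x|M. (cmod (f x))\<^sup>2) + 2 * (LINT x|M. (cmod (g x))\<^sup>2)"
proof -
  note i = sq_integrable_square[OF assms(1)] sq_integrable_square[OF assms(2)]
    sq_integrable_square[OF sq_integrable_add[OF assms]]
  have "(LINT x|M. (cmod (f x + g x))\<^sup>2) \<le> (LINT x|M. 2 * (cmod (f x))\<^sup>2 + 2 * (cmod (g x))\<^sup>2)"
    using i by (intro integral_mono cmod_add_square_le) auto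
  then show ?thesis using i by simp
qed

text \<open>Dominated convergence, with the majorant imposed directly on the squared error. It will
  be a constant for indicators and a multiple of |f|^2 for simple functions.\<close>

lemma square_error_tendsto_0:
  fixes s :: "nat \<Rightarrow> 'a \<Rightarrow> complex"
  assumes f: "f \<in> borel_measurable M" and s: "\<And>n. s n \<in> borel_measurable M"
    and lim: "\<And>x. x \<in> space M \<Longrightarrow> (\<lambda>n. s n x) \<longlonglongrightarrow> f x"
    and w: "integrable M w" and bound: "\<And>n x. x \<in> space M \<Longrightarrow> (cmod (f x - s n x))\<^sup>2 \<le> w x"
  shows "(\<lambda>n. LINT x|M. (cmod (f x - s n x))\<^sup>2) \<longlonglongrightarrow> 0"
proof -
  note [measurable] = f s
  have "(\<lambda>n. LINT x|M. (cmod (f x - s n x))\<^sup>2) \<longlonglongrightarrow> (LINT x|M. 0)"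
  proof (rule integral_dominated_convergence[where w = w])
    have "(\<lambda>n. (cmod (f x - s n x))\<^sup>2) \<longlonglongrightarrow> (cmod (f x - f x))\<^sup>2" if "x \<in> space M" for x
      by (intro tendsto_intros lim that)
    then show "AE x in M. (\<lambda>n. (cmod (f x - s n x))\<^sup>2) \<longlonglongrightarrow> 0" by simp
  qed (use w bound in auto)
  then show ?thesis by simp
qed

text \<open>\<open>T\<close> is a linear space of functions and \<open>u\<close> serves as its
  constant 1, from which complements of sets are formed. Equality with 1 is asked only on the space
  of \<open>M\<close>, since the trivial character has no controlled value at arguments such as the
  empty set, which is not a coset.\<close>

locale mean_square_subspace = finite_measure M for M :: "'a measure" +
  fixes T :: "('a \<Rightarrow> complex) set" and u :: "'a \<Rightarrow> complex"
  assumes T_sq_integrable: "\<And>t. t \<in> T \<Longrightarrow> sq_integrable M t"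
    and T_add: "\<And>s t. s \<in> T \<Longrightarrow> t \<in> T \<Longrightarrow> (\<lambda>x. s x + t x) \<in> T"
    and T_scale: "\<And>t c. t \<in> T \<Longrightarrow> (\<lambda>x. c * t x) \<in> T"
    and T_unit: "u \<in> T" and unit_eq_1: "\<And>x. x \<in> space M \<Longrightarrow> u x = 1"
begin

lemma approximable_of_T: "t \<in> T \<Longrightarrow> mean_square_approximable M T t"
  unfolding mean_square_approximable_def by (intro allI impI bexI[of _ t]) auto

lemma approximable_limit:
  assumes f: "sq_integrable M f" and s: "\<And>n. sq_integrable M (s n)"
    "\<And>n. mean_square_approximable M T (s n)"
    and lim: "(\<lambda>n::nat. LINT x|M. (cmod (f x - s n x))\<^sup>2) \<longlonglongrightarrow> 0"
  shows "mean_square_approximable M T f"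
  unfolding mean_square_approximable_def
proof (intro allI impI)
  fix \<epsilon> :: real assume "\<epsilon> > 0"
  \<comment> \<open>The quarter compensates for the factor 2 in front of each of the two squared
    errors.\<close>
  then have "\<forall>\<^sub>F n in sequentially. (LINT x|M. (cmod (f x - s n x))\<^sup>2) < \<epsilon> / 4"
    by (intro order_tendstoD(2)[OF lim]) simp
  then obtain n where n: "(LINT x|M. (cmod (f x - s n x))\<^sup>2) < \<epsilon> / 4"
    by (auto simp: eventually_sequentially)
  obtain t where t: "t \<in> T" "(LINT x|M. (cmod (s n x - t x))\<^sup>2) < \<epsilon> / 4"
    using s(2)[of n] \<open>\<epsilon> > 0\<close> unfolding mean_square_approximable_def
    by (meson divide_pos_pos zero_less_numeral)
  show "\<exists>t\<in>T. (LINT x|M. (cmod (f x - t x))\<^sup>2) < \<epsilon>"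
    using integral_cmod_add_square_le[OF sq_integrable_diff[OF f s(1)[of n]]
        sq_integrable_diff[OF s(1)[of n] T_sq_integrable[OF t(1)]]] n t
    by (intro bexI[of _ t]) auto
qed

lemma approximable_add:
  assumes f: "sq_integrable M f" "mean_square_approximable M T f"
    and g: "sq_integrable M g" "mean_square_approximable M T g"
  shows "mean_square_approximable M T (\<lambda>x. f x + g x)"
  unfolding mean_square_approximable_def
proof (intro allI impI)
  fix \<epsilon> :: real assume "\<epsilon> > 0"
  then have "\<epsilon> / 4 > 0" by simp
  obtain s where s: "s \<in> T" "(LINT x|M. (cmod (f x - s x))\<^sup>2) < \<epsilon> / 4"
    using f(2) \<open>\<epsilon> / 4 > 0\<close> unfolding mean_square_approximable_def by blast
  obtain t where t: "t \<in> T" "(LINT x|M. (cmod (g x - t x))\<^sup>2) < \<epsilon> / 4"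
    using g(2) \<open>\<epsilon> / 4 > 0\<close> unfolding mean_square_approximable_def by blast
  have "(LINT x|M. (cmod ((f x - s x) + (g x - t x)))\<^sup>2) < \<epsilon>"
    using integral_cmod_add_square_le[OF sq_integrable_diff[OF f(1) T_sq_integrable[OF s(1)]]
        sq_integrable_diff[OF g(1) T_sq_integrable[OF t(1)]]] s t by linarith
  then show "\<exists>t\<in>T. (LINT x|M. (cmod (f x + g x - t x))\<^sup>2) < \<epsilon>"
    by (intro bexI[OF _ T_add[OF s(1) t(1)]]) (simp add: algebra_simps)
qed

lemma approximable_scale:
  assumes f: "mean_square_approximable M T f"
  shows "mean_square_approximable M T (\<lambda>x. c * f x)"
proof (cases "c = 0")
  case True
  \<comment> \<open>The zero function is in \<open>T\<close> as 0 times the unit; the other case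
    divides by |c|^2.\<close>
  then show ?thesis using approximable_of_T[OF T_scale[OF T_unit, of 0]] by simp
next
  case False
  show ?thesis
    unfolding mean_square_approximable_def
  proof (intro allI impI)
    fix \<epsilon> :: real assume "\<epsilon> > 0"
    then have "\<epsilon> / (cmod c)\<^sup>2 > 0" using False by simp
    then obtain t where t: "t \<in> T" "(LINT x|M. (cmod (f x - t x))\<^sup>2) < \<epsilon> / (cmod c)\<^sup>2"
      using f unfolding mean_square_approximable_def by blast
    have "(LINT x|M. (cmod (c * f x - c * t x))\<^sup>2) = (cmod c)\<^sup>2 * (LINT x|M. (cmod (f x - t x))\<^sup>2)"
      by (simp add: norm_mult power_mult_distrib flip: right_diff_distrib)
    also have "\<dots> < \<epsilon>" using t(2) False by (simp add: field_simps)
    finally show "\<exists>t\<in>T. (LINT x|M. (cmod (c * f x - t x))\<^sup>2) < \<epsilon>"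
      by (intro bexI[OF _ T_scale[OF t(1)]])
  qed
qed

lemma approximable_sum:
  assumes "finite J" "\<And>j. j \<in> J \<Longrightarrow> sq_integrable M (f j) \<and> mean_square_approximable M T (f j)"
  shows "mean_square_approximable M T (\<lambda>x. \<Sum>j\<in>J. f j x)"
  using assms
proof (induction J rule: finite_induct)
  case empty
  show ?case using approximable_of_T[OF T_scale[OF T_unit, of 0]] by simp
next
  case (insert j J)
  then show ?case by (simp add: approximable_add sq_integrable_sum)
qed

lemma sq_integrable_indicator: "S \<in> sets M \<Longrightarrow> sq_integrable M (indicator S)"
  by (rule sq_integrable_bounded[where C = 1]) (auto simp: indicator_def)

text \<open>Linearity handles complements and dominated convergence handles disjoint unions, but
  products of approximable functions are not under control. The sets with approximable indicator are
  thus only known to form a Dynkin system, whence the intersection-stable generator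
  \<open>G\<close>.\<close>

lemma approximable_indicator:
  assumes G: "sets M = sigma_sets (space M) G" "G \<subseteq> Pow (space M)" "Int_stable G"
    and app: "\<And>S. S \<in> G \<Longrightarrow> mean_square_approximable M T (indicator S)"
    and S: "S \<in> sets M"
  shows "mean_square_approximable M T (indicator S)"
proof -
  have "S \<in> sigma_sets (space M) G" using S G(1) by simp
  from G(3,2) this show ?thesis
  proof (induction rule: sigma_sets_induct_disjoint)
    case (basic A)
    then show ?case by (rule app)
  next
    case empty
    then show ?case using approximable_of_T[OF T_scale[OF T_unit, of 0]] by (simp add: indicator_def)
  next
    case (compl A)
    have A: "A \<in> sets M" using compl G(1) by simp
    have *: "mean_square_approximable M T (\<lambda>x. u x + (-1) * indicator A x)"
      by (rule approximable_add[OF T_sq_integrable[OF T_unit] approximable_of_T[OF T_unit]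
            sq_integrable_scale[OF sq_integrable_indicator[OF A]] approximable_scale[OF compl(2)]])
    \<comment> \<open>The unit is 1 only on the space of \<open>M\<close>, so the indicator of the
      complement is replaced under the integral.\<close>
    have "(LINT x|M. (cmod (indicator (space M - A) x - t x))\<^sup>2) =
        (LINT x|M. (cmod (u x + (-1) * indicator A x - t x))\<^sup>2)" for t
      by (rule Bochner_Integration.integral_cong) (auto simp: indicator_def unit_eq_1)
    then show ?case using * by (simp add: mean_square_approximable_def)
  next
    case (union A)
    have A: "A n \<in> sets M" for n using union G(1) by auto
    \<comment> \<open>Disjointness makes a partial sum the indicator of a partial union, so the
      error takes only the values 0 and 1 and the constant 1 is a majorant.\<close>
    have part: "(\<Sum>i<n. indicator (A i) x :: complex) = indicator (\<Union>i<n. A i) x" for n x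
      by (rule indicator_UN_disjoint[symmetric])
        (use union(1) in \<open>auto simp: disjoint_family_on_def\<close>)
    have lim: "(\<lambda>n. \<Sum>i<n. indicator (A i) x :: complex) \<longlonglongrightarrow> indicator (\<Union>i. A i) x" for x
      unfolding part by (rule LIMSEQ_indicator_UN)
    have si: "sq_integrable M (\<lambda>x. \<Sum>i<n. indicator (A i) x)" for n
      by (intro sq_integrable_sum sq_integrable_indicator A)
    show ?case
    proof (rule approximable_limit)
      show "sq_integrable M (indicator (\<Union>i. A i))" by (intro sq_integrable_indicator sets.countable_UN) (use A in auto)
      show "sq_integrable M (\<lambda>x. \<Sum>i<n. indicator (A i) x)" for n by (rule si)
      show "mean_square_approximable M T (\<lambda>x. \<Sum>i<n. indicator (A i) x)" for n
        using union(3) A by (intro approximable_sum) (auto intro: sq_integrable_indicator)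
      show "(\<lambda>n. LINT x|M. (cmod (indicator (\<Union>i. A i) x - (\<Sum>i<n. indicator (A i) x)))\<^sup>2) \<longlonglongrightarrow> 0"
      proof (rule square_error_tendsto_0[where w = "\<lambda>_. 1"])
        show "(cmod (indicator (\<Union>i. A i) x - (\<Sum>i<n. indicator (A i) x)))\<^sup>2 \<le> 1" for n x
          unfolding part by (auto simp: indicator_def)
      qed (use A lim sq_integrable_measurable[OF si] in auto)
    qed
  qed
qed

proposition mean_square_approximable_all:
  assumes G: "sets M = sigma_sets (space M) G" "G \<subseteq> Pow (space M)" "Int_stable G"
    and app: "\<And>S. S \<in> G \<Longrightarrow> mean_square_approximable M T (indicator S)"
    and f: "sq_integrable M f"
  shows "mean_square_approximable M T f"
proof -
  obtain s where s: "\<And>i. simple_function M (s i)"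
    "\<And>x. x \<in> space M \<Longrightarrow> (\<lambda>i. s i x) \<longlonglongrightarrow> f x"
    "\<And>i x. x \<in> space M \<Longrightarrow> dist (s i x) 0 \<le> 2 * dist (f x) 0"
    using borel_measurable_implies_sequence_metric[OF sq_integrable_measurable[OF f], of 0] by blast
  have sm: "s i \<in> borel_measurable M" for i using s(1) by (rule borel_measurable_simple_function)
  \<comment> \<open>From |s i| <= 2 |f| follows |f - s i| <= 3 |f|, whose square gives the factor
    9.\<close>
  have w: "integrable M (\<lambda>x. 9 * (cmod (f x))\<^sup>2)" using sq_integrable_square[OF f] by simp
  have fin: "finite (s i ` space M)" for i using s(1) by (simp add: simple_function_def)
  have si: "sq_integrable M (s i)" for i
  proof (rule sq_integrable_bounded[OF sm])
    show "cmod (s i x) \<le> Max (insert 0 (cmod ` s i ` space M))" if "x \<in> space M" for x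
      using fin that by (intro Max_ge) auto
  qed
  show ?thesis
  proof (rule approximable_limit[OF f si])
    show "mean_square_approximable M T (s i)" for i
    proof -
      have lv: "s i -` {y} \<inter> space M \<in> sets M" for y using sm[of i] by measurable
      have "mean_square_approximable M T (\<lambda>x. \<Sum>y\<in>s i ` space M. y * indicator (s i -` {y} \<inter> space M) x)"
        using lv approximable_indicator[OF G app] fin
        by (intro approximable_sum) (auto intro: sq_integrable_indicator approximable_scale sq_integrable_scale)
      moreover have "(LINT x|M. (cmod (s i x - t x))\<^sup>2) =
          (LINT x|M. (cmod ((\<Sum>y\<in>s i ` space M. y * indicator (s i -` {y} \<inter> space M) x) - t x))\<^sup>2)" for t
      proof (rule Bochner_Integration.integral_cong)
        fix x assume x: "x \<in> space M"
        have "(\<Sum>y\<in>s i ` space M. y * indicator (s i -` {y} \<inter> space M) x) =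
            (\<Sum>y\<in>s i ` space M. if y = s i x then y else 0)"
          using x by (intro sum.cong) (auto simp: indicator_def)
        also have "\<dots> = s i x" using fin x by simp
        finally show "(cmod (s i x - t x))\<^sup>2 =
          (cmod ((\<Sum>y\<in>s i ` space M. y * indicator (s i -` {y} \<inter> space M) x) - t x))\<^sup>2" by simp
      qed simp
      ultimately show ?thesis by (simp add: mean_square_approximable_def)
    qed
    show "(\<lambda>n. LINT x|M. (cmod (f x - s n x))\<^sup>2) \<longlonglongrightarrow> 0"
    proof (rule square_error_tendsto_0[OF sq_integrable_measurable[OF f] sm s(2) w])
      show "(cmod (f x - s n x))\<^sup>2 \<le> 9 * (cmod (f x))\<^sup>2" if "x \<in> space M" for n x
      proof -
        have "cmod (f x - s n x) \<le> 3 * cmod (f x)"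
          using norm_triangle_ineq4[of "f x" "s n x"] s(3)[OF that, of n] by simp
        then have "(cmod (f x - s n x))\<^sup>2 \<le> (3 * cmod (f x))\<^sup>2" by (intro power_mono) auto
        then show ?thesis by (simp add: power_mult_distrib)
      qed
    qed
  qed
qed

end

section \<open>Characters in period coordinates\<close>

text \<open>The solution of Z = P + Q \<Omega> for real P and Q: with \<Omega> = X + iY the
  imaginary part reads V = Q Y and the real part U = P + Q X.\<close>

definition coord_q :: "complex^'g^'g \<Rightarrow> complex^'g^'h \<Rightarrow> real^'g^'h" where
  "coord_q \<Omega> Z = map_matrix Im Z ** matrix_inv (map_matrix Im \<Omega>)"

definition coord_p :: "complex^'g^'g \<Rightarrow> complex^'g^'h \<Rightarrow> real^'g^'h" where
  "coord_p \<Omega> Z = map_matrix Re Z - coord_q \<Omega> Z ** map_matrix Re \<Omega>"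

definition period_point :: "complex^'g^'g \<Rightarrow> real^'g^'h \<Rightarrow> real^'g^'h \<Rightarrow> complex^'g^'h" where
  "period_point \<Omega> P Q = map_matrix complex_of_real P + map_matrix complex_of_real Q ** \<Omega>"

lemma trace_transpose_mult:
  fixes A B :: "real^'g^'h"
  shows "trace (transpose A ** B) = (\<Sum>i\<in>UNIV. \<Sum>j\<in>UNIV. A $ i $ j * B $ i $ j)"
  unfolding trace_def transpose_def matrix_matrix_mult_def by simp (rule sum.swap)

lemma trace_mult_transpose:
  fixes A B :: "real^'g^'h"
  shows "trace (A ** transpose B) = (\<Sum>i\<in>UNIV. \<Sum>j\<in>UNIV. A $ i $ j * B $ i $ j)"
  by (simp add: trace_def transpose_def matrix_matrix_mult_def)

text \<open>Insert U = P + Q X and V = Q Y. Since the inverse of Y is symmetric, it cancels against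
  the transpose of V and leaves the transpose of Q. The two terms that contain X cancel because X is
  symmetric and the trace is invariant under transposition and cyclic exchange.\<close>

lemma lattice_char_coords:
  fixes \<Omega> :: "complex^'g^'g" and A B :: "int^'g^'h"
  assumes \<Omega>: "\<Omega> \<in> siegel_upper_half_space"
  shows "lattice_char \<Omega> A B Z = cis (2 * pi * (\<Sum>i\<in>UNIV. \<Sum>j\<in>UNIV.
    of_int (A $ i $ j) * coord_p \<Omega> Z $ i $ j + of_int (B $ i $ j) * coord_q \<Omega> Z $ i $ j))"
proof -
  define X Y where "X = map_matrix Re \<Omega>" and "Y = map_matrix Im \<Omega>"
  define U V where "U = map_matrix Re Z" and "V = map_matrix Im Z"
  define A' B' where "A' = map_matrix real_of_int A" and "B' = map_matrix real_of_int B"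
  define q where "q = coord_q \<Omega> Z"
  define p where "p = coord_p \<Omega> Z"
  have sym: "transpose X = X" "transpose Y = Y"
    using \<Omega> by (auto simp: siegel_upper_half_space_def X_def Y_def transpose_def vec_eq_iff)
  have inv: "Y ** matrix_inv Y = mat 1" "matrix_inv Y ** Y = mat 1"
    using siegel_inverse[OF \<Omega>] by (simp_all add: Y_def)
  have symi: "transpose (matrix_inv Y) = matrix_inv Y"
  proof -
    have "transpose (matrix_inv Y) ** Y = transpose (Y ** matrix_inv Y)"
      by (simp add: matrix_transpose_mul sym)
    then have "transpose (matrix_inv Y) ** Y = mat 1" by (simp add: inv transpose_mat)
    then have "transpose (matrix_inv Y) ** (Y ** matrix_inv Y) = matrix_inv Y"
      by (simp add: matrix_mul_assoc)
    then show ?thesis by (simp add: inv)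
  qed
  have tq: "matrix_inv Y ** transpose V = transpose q"
    by (simp add: q_def coord_q_def V_def[symmetric] Y_def[symmetric] matrix_transpose_mul symi)
  have U: "U = p + q ** X"
    by (simp add: p_def q_def coord_p_def U_def X_def)
  have c: "trace (transpose A' ** (q ** X)) = trace (A' ** X ** transpose q)"
  proof -
    have "trace (transpose A' ** (q ** X)) = trace (transpose (transpose A' ** (q ** X)))"
      by (simp add: trace_def transpose_def)
    also have "\<dots> = trace (X ** transpose q ** A')"
      by (simp add: matrix_transpose_mul sym transpose_transpose)
    also have "\<dots> = trace (A' ** (X ** transpose q))"
      by (rule trace_mul_sym)
    finally show ?thesis by (simp add: matrix_mul_assoc)
  qed
  have d: "(B' - A' ** X) ** transpose q = B' ** transpose q - A' ** X ** transpose q"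
    by (simp add: vec_eq_iff matrix_matrix_mult_def algebra_simps sum_subtractf)
  have "trace (transpose A' ** U) + trace ((B' - A' ** X) ** matrix_inv Y ** transpose V)
      = trace (transpose A' ** p) + trace (B' ** transpose q)"
    by (simp add: matrix_mul_assoc[symmetric] tq)
      (simp add: U matrix_add_ldistrib trace_add c d trace_sub)
  also have "\<dots> = (\<Sum>i\<in>UNIV. \<Sum>j\<in>UNIV.
      of_int (A $ i $ j) * p $ i $ j + of_int (B $ i $ j) * q $ i $ j)"
    by (simp add: trace_transpose_mult trace_mult_transpose A'_def B'_def sum.distrib)
  finally show ?thesis
    unfolding lattice_char_def Let_def X_def[symmetric] Y_def[symmetric] U_def[symmetric]
      V_def[symmetric] A'_def[symmetric] B'_def[symmetric] p_def[symmetric] q_def[symmetric]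
    by (simp add: cis_conv_exp mult_ac)
qed

lemma coord_q_period_point:
  assumes "\<Omega> \<in> siegel_upper_half_space"
  shows "coord_q \<Omega> (period_point \<Omega> P Q) = Q"
proof -
  have "map_matrix Im (period_point \<Omega> P Q) = Q ** map_matrix Im \<Omega>"
    by (simp add: period_point_def vec_eq_iff matrix_matrix_mult_def)
  then show ?thesis
    by (simp add: coord_q_def matrix_mul_assoc[symmetric] siegel_inverse[OF assms])
qed

lemma coord_p_period_point:
  assumes "\<Omega> \<in> siegel_upper_half_space"
  shows "coord_p \<Omega> (period_point \<Omega> P Q) = P"
proof -
  have "map_matrix Re (period_point \<Omega> P Q) = P + Q ** map_matrix Re \<Omega>"
    by (simp add: period_point_def vec_eq_iff matrix_matrix_mult_def)
  then show ?thesis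
    by (simp add: coord_p_def coord_q_period_point[OF assms])
qed

lemma period_point_coords:
  assumes "\<Omega> \<in> siegel_upper_half_space"
  shows "period_point \<Omega> (coord_p \<Omega> Z) (coord_q \<Omega> Z) = Z"
proof -
  have "map_matrix Re (period_point \<Omega> (coord_p \<Omega> Z) (coord_q \<Omega> Z)) = map_matrix Re Z"
    by (simp add: period_point_def vec_eq_iff matrix_matrix_mult_def coord_p_def)
  moreover have "map_matrix Im (period_point \<Omega> (coord_p \<Omega> Z) (coord_q \<Omega> Z)) = map_matrix Im Z"
  proof -
    have "map_matrix Im (period_point \<Omega> (coord_p \<Omega> Z) (coord_q \<Omega> Z)) = coord_q \<Omega> Z ** map_matrix Im \<Omega>"
      by (simp add: period_point_def vec_eq_iff matrix_matrix_mult_def)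
    then show ?thesis by (simp add: coord_q_def matrix_mul_assoc[symmetric] siegel_inverse[OF assms])
  qed
  ultimately show ?thesis by (simp add: vec_eq_iff complex_eq_iff)
qed

lemma coord_q_add: "coord_q \<Omega> (Z + W) = coord_q \<Omega> Z + coord_q \<Omega> W"
  by (simp add: coord_q_def vec_eq_iff matrix_matrix_mult_def algebra_simps sum.distrib)

lemma coord_p_add: "coord_p \<Omega> (Z + W) = coord_p \<Omega> Z + coord_p \<Omega> W"
  by (simp add: coord_p_def coord_q_add vec_eq_iff matrix_matrix_mult_def algebra_simps sum.distrib)

lemma coord_q_scaleR: "coord_q \<Omega> (r *\<^sub>R Z) = r *\<^sub>R coord_q \<Omega> Z"
  by (simp add: coord_q_def vec_eq_iff matrix_matrix_mult_def sum_distrib_left mult_ac)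

lemma coord_p_scaleR: "coord_p \<Omega> (r *\<^sub>R Z) = r *\<^sub>R coord_p \<Omega> Z"
  by (simp add: coord_p_def coord_q_scaleR vec_eq_iff matrix_matrix_mult_def sum_distrib_left algebra_simps)

lemma linear_coord_p: "linear (coord_p \<Omega>)"
  by (intro linearI coord_p_add coord_p_scaleR)

lemma linear_coord_q: "linear (coord_q \<Omega>)"
  by (intro linearI coord_q_add coord_q_scaleR)

lemma continuous_on_coord [continuous_intros]:
  "continuous_on S (\<lambda>Z. coord_p \<Omega> Z)" "continuous_on S (\<lambda>Z. coord_q \<Omega> Z)"
  using linear_coord_p linear_coord_q by (auto intro: linear_continuous_on linear_conv_bounded_linear[THEN iffD1])

lemma continuous_on_lattice_char:
  assumes "\<Omega> \<in> siegel_upper_half_space"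
  shows "continuous_on S (lattice_char \<Omega> A B)"
  unfolding lattice_char_coords[OF assms, abs_def] by (intro continuous_intros)

lemma period_lattice_iff:
  fixes \<Omega> :: "complex^'g^'g" and Z :: "complex^'g^'h"
  assumes "\<Omega> \<in> siegel_upper_half_space"
  shows "Z \<in> period_lattice \<Omega> \<longleftrightarrow> (\<forall>i j. coord_p \<Omega> Z $ i $ j \<in> \<int> \<and> coord_q \<Omega> Z $ i $ j \<in> \<int>)"
proof -
  have pp: "map_matrix of_int P + map_matrix of_int Q ** \<Omega> =
      period_point \<Omega> (map_matrix of_int P) (map_matrix of_int Q)" for P Q :: "int^'g^'h"
    by (simp add: period_point_def vec_eq_iff matrix_matrix_mult_def)
  show ?thesis
  proof
    assume "Z \<in> period_lattice \<Omega>"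
    then obtain P Q :: "int^'g^'h" where "Z = period_point \<Omega> (map_matrix of_int P) (map_matrix of_int Q)"
      unfolding period_lattice_def pp by blast
    then show "\<forall>i j. coord_p \<Omega> Z $ i $ j \<in> \<int> \<and> coord_q \<Omega> Z $ i $ j \<in> \<int>"
      by (simp add: coord_p_period_point[OF assms] coord_q_period_point[OF assms])
  next
    assume Z: "\<forall>i j. coord_p \<Omega> Z $ i $ j \<in> \<int> \<and> coord_q \<Omega> Z $ i $ j \<in> \<int>"
    define P Q :: "int^'g^'h" where "P = (\<chi> i j. \<lfloor>coord_p \<Omega> Z $ i $ j\<rfloor>)" and "Q = (\<chi> i j. \<lfloor>coord_q \<Omega> Z $ i $ j\<rfloor>)"
    have "map_matrix of_int P = coord_p \<Omega> Z" "map_matrix of_int Q = coord_q \<Omega> Z"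
      using Z by (simp_all add: P_def Q_def vec_eq_iff)
    then have "Z = period_point \<Omega> (map_matrix of_int P) (map_matrix of_int Q)"
      by (simp add: period_point_coords[OF assms])
    then show "Z \<in> period_lattice \<Omega>" unfolding period_lattice_def pp by blast
  qed
qed

lemma lattice_char_add:
  assumes "\<Omega> \<in> siegel_upper_half_space"
  shows "lattice_char \<Omega> A B (Z + W) = lattice_char \<Omega> A B Z * lattice_char \<Omega> A B W"
  unfolding lattice_char_coords[OF assms] cis_mult coord_p_add coord_q_add
  by (simp add: sum.distrib algebra_simps)

lemma lattice_char_mult:
  assumes "\<Omega> \<in> siegel_upper_half_space"
  shows "lattice_char \<Omega> A B Z * lattice_char \<Omega> A' B' Z = lattice_char \<Omega> (A + A') (B + B') Z"
  unfolding lattice_char_coords[OF assms] cis_mult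
  by (simp add: sum.distrib algebra_simps)

lemma lattice_char_mult_cnj:
  assumes "\<Omega> \<in> siegel_upper_half_space"
  shows "lattice_char \<Omega> A B Z * cnj (lattice_char \<Omega> A' B' Z) = lattice_char \<Omega> (A - A') (B - B') Z"
  unfolding lattice_char_coords[OF assms] cis_cnj cis_mult
  by (simp add: sum.distrib sum_subtractf algebra_simps)

lemma lattice_char_0: "\<Omega> \<in> siegel_upper_half_space \<Longrightarrow> lattice_char \<Omega> 0 0 Z = 1"
  by (simp add: lattice_char_coords)

lemma cmod_lattice_char: "\<Omega> \<in> siegel_upper_half_space \<Longrightarrow> cmod (lattice_char \<Omega> A B Z) = 1"
  by (simp add: lattice_char_coords)

lemma sum_entries_axis:
  fixes f :: "'h::finite \<Rightarrow> 'g::finite \<Rightarrow> 'a::comm_monoid_add"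
  shows "(\<Sum>i\<in>UNIV. \<Sum>j\<in>UNIV. if i = k \<and> j = l then f i j else 0) = f k l"
proof -
  have "(\<Sum>i\<in>UNIV. \<Sum>j\<in>UNIV. if i = k \<and> j = l then f i j else 0) =
      (\<Sum>i\<in>UNIV. if i = k then \<Sum>j\<in>UNIV. if j = l then f i j else 0 else 0)"
    by (intro sum.cong refl) auto
  then show ?thesis by simp
qed

lemma lattice_char_nontrivial:
  fixes A B :: "int^'g^'h"
  assumes \<Omega>: "\<Omega> \<in> siegel_upper_half_space" and AB: "(A, B) \<noteq> (0, 0)"
  obtains Z where "lattice_char \<Omega> A B Z = -1"
proof -
  note c = lattice_char_coords[OF \<Omega>] coord_p_period_point[OF \<Omega>] coord_q_period_point[OF \<Omega>]
  have if_mult: "x * (if b then y else 0) = (if b then x * y else 0)" for x y :: real and b by simp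
  consider k l where "A $ k $ l \<noteq> 0" | k l where "B $ k $ l \<noteq> 0"
    using AB by (auto simp: vec_eq_iff)
  then show ?thesis
  proof cases
    case 1
    \<comment> \<open>A single nonzero entry, chosen so that its product with
      \<open>A $ k $ l\<close> is 1/2; the phase is then \<pi>.\<close>
    let ?P = "(\<chi> i j. if i = k \<and> j = l then 1 / (2 * of_int (A $ k $ l)) else 0) :: real^'g^'h"
    have "lattice_char \<Omega> A B (period_point \<Omega> ?P 0) = cis pi"
      unfolding c using 1 by (simp add: if_mult sum_entries_axis)
    then show ?thesis by (intro that) simp
  next
    case 2
    let ?Q = "(\<chi> i j. if i = k \<and> j = l then 1 / (2 * of_int (B $ k $ l)) else 0) :: real^'g^'h"
    have "lattice_char \<Omega> A B (period_point \<Omega> 0 ?Q) = cis pi"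
      unfolding c using 2 by (simp add: if_mult sum_entries_axis)
    then show ?thesis by (intro that) simp
  qed
qed

section \<open>Orthonormality\<close>

text \<open>The union of the cosets in the preimage of an open set is the preimage under the
  continuous lift, so the preimage is already a generator of the sigma-algebra.\<close>

lemma torus_char_measurable:
  fixes \<Omega> :: "complex^'g^'g" and A B :: "int^'g^'h"
  assumes \<Omega>: "\<Omega> \<in> siegel_upper_half_space"
  shows "torus_char \<Omega> A B \<in> borel_measurable (torus_borel \<Omega>)"
proof (rule borel_measurableI)
  fix O' :: "complex set" assume "open O'"
  let ?S = "torus_char \<Omega> A B -` O' \<inter> torus \<Omega>"
  have "Z \<in> \<Union>?S \<longleftrightarrow> Z \<in> lattice_char \<Omega> A B -` O'" for Z
    by (subst in_Union_torus[where \<Omega> = \<Omega>]) (auto simp: torus_char_proj[OF \<Omega>] torus_proj_in_torus)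
  then have "\<Union>?S = lattice_char \<Omega> A B -` O'" by blast
  moreover have "open (lattice_char \<Omega> A B -` O')"
    by (rule open_vimage[OF \<open>open O'\<close> continuous_on_lattice_char[OF \<Omega>]])
  ultimately show "torus_char \<Omega> A B -` O' \<inter> space (torus_borel \<Omega>) \<in> sets (torus_borel \<Omega>)"
    unfolding sets_torus_borel space_torus_borel by (intro sigma_sets.Basic) auto
qed

text \<open>Invariance is assumed for images of sets, whereas a change of variables in an integral
  refers to preimages. The preimage under translation by \<open>a\<close> is the image under
  translation by \<open>- a\<close>.\<close>

lemma normalized_invariant_volume_distr:
  fixes \<Omega> :: "complex^'g^'g" and dv :: "(complex^'g^'h) set measure"
  assumes dv: "normalized_invariant_volume \<Omega> dv"
  shows "distr dv dv ((`) ((+) a)) = dv"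
proof (rule measure_eqI)
  have sp: "space dv = torus \<Omega>" and st: "sets dv = sets (torus_borel \<Omega>)"
    and inv: "\<And>a S. S \<in> sets dv \<Longrightarrow> emeasure dv ((`) ((+) a) ` S) = emeasure dv S"
    using dv by (auto simp: normalized_invariant_volume_def)
  have m: "(`) ((+) a) \<in> measurable dv dv"
    using translate_measurable[of a \<Omega>] by (simp add: measurable_cong_sets[OF st st])
  fix S assume "S \<in> sets (distr dv dv ((`) ((+) a)))"
  then have S: "S \<in> sets dv" by simp
  then have sub: "S \<subseteq> torus \<Omega>" using sets.sets_into_space sp by blast
  have "(`) ((+) a) -` S \<inter> space dv = (`) ((+) (- a)) ` S"
  proof (intro equalityI subsetI)
    fix C assume C: "C \<in> (`) ((+) a) -` S \<inter> space dv"
    then obtain Z where "C = torus_proj \<Omega> Z" using torusE sp by blast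
    then have "C = (+) (- a) ` ((+) a ` C)" by (simp add: translate_torus_proj del: uminus_add_conv_diff)
    then show "C \<in> (`) ((+) (- a)) ` S" using C by blast
  next
    fix C assume "C \<in> (`) ((+) (- a)) ` S"
    then obtain D where "D \<in> S" "C = (+) (- a) ` D" by blast
    moreover obtain Z where "D = torus_proj \<Omega> Z" using \<open>D \<in> S\<close> sub torusE by blast
    ultimately show "C \<in> (`) ((+) a) -` S \<inter> space dv"
      by (simp add: translate_torus_proj torus_proj_in_torus sp del: uminus_add_conv_diff)
  qed
  then show "emeasure (distr dv dv ((`) ((+) a))) S = emeasure dv S"
    using inv[OF S, of "- a"] by (simp add: emeasure_distr[OF m S])
qed simp

lemma torus_char_integral:
  fixes \<Omega> :: "complex^'g^'g" and dv :: "(complex^'g^'h) set measure"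
  assumes \<Omega>: "\<Omega> \<in> siegel_upper_half_space" and dv: "normalized_invariant_volume \<Omega> dv"
  shows "(LINT x|dv. torus_char \<Omega> A B x) = (if (A, B) = (0, 0) then 1 else 0)"
proof (cases "(A, B) = (0, 0)")
  case True
  have sp: "space dv = torus \<Omega>" and one: "emeasure dv (space dv) = 1"
    using dv by (auto simp: normalized_invariant_volume_def)
  have "(LINT x|dv. torus_char \<Omega> A B x) = (LINT x|dv. 1)"
    by (rule Bochner_Integration.integral_cong)
      (use True in \<open>auto simp: sp torus_char_proj[OF \<Omega>] lattice_char_0[OF \<Omega>] elim!: torusE\<close>)
  then show ?thesis using True one by (simp add: measure_def)
next
  case False
  then obtain a where a: "lattice_char \<Omega> A B a = -1" using lattice_char_nontrivial[OF \<Omega>] by blast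
  have sp: "space dv = torus \<Omega>" and st: "sets dv = sets (torus_borel \<Omega>)"
    using dv by (auto simp: normalized_invariant_volume_def)
  have m: "(`) ((+) a) \<in> measurable dv dv"
    using translate_measurable[of a \<Omega>] by (simp add: measurable_cong_sets[OF st st])
  have cm: "torus_char \<Omega> A B \<in> borel_measurable dv"
    using torus_char_measurable[OF \<Omega>] by (simp add: measurable_cong_sets[OF st refl])
  have "(LINT x|dv. torus_char \<Omega> A B x) = (LINT x|distr dv dv ((`) ((+) a)). torus_char \<Omega> A B x)"
    by (simp add: normalized_invariant_volume_distr[OF dv])
  also have "\<dots> = (LINT x|dv. torus_char \<Omega> A B ((+) a ` x))"
    by (rule integral_distr[OF m cm])
  also have "\<dots> = (LINT x|dv. - torus_char \<Omega> A B x)"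
    by (rule Bochner_Integration.integral_cong)
      (auto simp: sp translate_torus_proj torus_char_proj[OF \<Omega>] lattice_char_add[OF \<Omega>] a elim!: torusE)
  finally show ?thesis using False by simp
qed

text \<open>A character times the conjugate of another is the character of the difference of the
  indices, so the inner product is the integral of a single character.\<close>

lemma torus_char_orthonormal:
  fixes \<Omega> :: "complex^'g^'g" and dv :: "(complex^'g^'h) set measure"
  assumes \<Omega>: "\<Omega> \<in> siegel_upper_half_space" and dv: "normalized_invariant_volume \<Omega> dv"
  shows "(LINT x|dv. torus_char \<Omega> A B x * cnj (torus_char \<Omega> A' B' x)) = (if (A, B) = (A', B') then 1 else 0)"
proof -
  have sp: "space dv = torus \<Omega>" using dv by (auto simp: normalized_invariant_volume_def)
  have "(LINT x|dv. torus_char \<Omega> A B x * cnj (torus_char \<Omega> A' B' x)) =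
      (LINT x|dv. torus_char \<Omega> (A - A') (B - B') x)"
    by (rule Bochner_Integration.integral_cong)
      (auto simp: sp torus_char_proj[OF \<Omega>] lattice_char_mult_cnj[OF \<Omega>] elim!: torusE)
  then show ?thesis by (simp add: torus_char_integral[OF \<Omega> dv])
qed

section \<open>Completeness\<close>

text \<open>Combinations are taken over indices rather than over a set of functions, so that
  membership directly yields the finite index set and coefficients that the basis property asks
  for.\<close>

definition fun_span :: "('i \<Rightarrow> 'a \<Rightarrow> complex) \<Rightarrow> ('a \<Rightarrow> complex) set" where
  "fun_span e = {\<lambda>x. \<Sum>j\<in>J. c j * e j x | J c. finite J}"

lemma fun_spanI: "finite J \<Longrightarrow> (\<lambda>x. \<Sum>j\<in>J. c j * e j x) \<in> fun_span e"
  unfolding fun_span_def by blast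

lemma fun_spanE:
  assumes "t \<in> fun_span e"
  obtains J c where "finite J" "t = (\<lambda>x. \<Sum>j\<in>J. c j * e j x)"
  using assms unfolding fun_span_def by blast

lemma fun_span_base: "e i \<in> fun_span e"
  using fun_spanI[of "{i}" "\<lambda>_. 1" e] by simp

lemma fun_span_scale:
  assumes "t \<in> fun_span e" shows "(\<lambda>x. a * t x) \<in> fun_span e"
proof -
  obtain J c where "finite J" "t = (\<lambda>x. \<Sum>j\<in>J. c j * e j x)" using assms by (rule fun_spanE)
  then show ?thesis using fun_spanI[of J "\<lambda>j. a * c j" e] by (simp add: sum_distrib_left mult.assoc)
qed

lemma fun_span_add:
  assumes "s \<in> fun_span e" "t \<in> fun_span e" shows "(\<lambda>x. s x + t x) \<in> fun_span e"
proof -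
  obtain J c where J: "finite J" "s = (\<lambda>x. \<Sum>j\<in>J. c j * e j x)" using assms(1) by (rule fun_spanE)
  obtain K d where K: "finite K" "t = (\<lambda>x. \<Sum>j\<in>K. d j * e j x)" using assms(2) by (rule fun_spanE)
  have "(\<Sum>j\<in>J \<union> K. ((if j \<in> J then c j else 0) + (if j \<in> K then d j else 0)) * e j x) = s x + t x" for x
  proof -
    have "(\<Sum>j\<in>J \<union> K. (if j \<in> J then c j else 0) * e j x) = s x"
      unfolding J(2) by (rule sum.mono_neutral_cong_right) (use J K in auto)
    moreover have "(\<Sum>j\<in>J \<union> K. (if j \<in> K then d j else 0) * e j x) = t x"
      unfolding K(2) by (rule sum.mono_neutral_cong_right) (use J K in auto)
    ultimately show ?thesis by (simp only: distrib_right sum.distrib)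
  qed
  then show ?thesis
    using fun_spanI[of "J \<union> K" "\<lambda>j. (if j \<in> J then c j else 0) + (if j \<in> K then d j else 0)" e] J(1) K(1)
    by simp
qed

lemma fun_span_sum:
  "(\<And>j. j \<in> J \<Longrightarrow> f j \<in> fun_span e) \<Longrightarrow> (\<lambda>x. \<Sum>j\<in>J. f j x) \<in> fun_span e"
proof (induction J rule: infinite_finite_induct)
  case (insert j J)
  then show ?case by (simp add: fun_span_add)
qed (use fun_spanI[of "{}" _ e] in simp_all)

lemma fun_span_mult:
  assumes e: "\<And>i j. (\<lambda>x. e i x * e j x) \<in> fun_span e"
    and "s \<in> fun_span e" "t \<in> fun_span e"
  shows "(\<lambda>x. s x * t x) \<in> fun_span e"
proof -
  obtain J c where J: "finite J" "s = (\<lambda>x. \<Sum>j\<in>J. c j * e j x)" using assms(2) by (rule fun_spanE)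
  obtain K d where K: "finite K" "t = (\<lambda>x. \<Sum>j\<in>K. d j * e j x)" using assms(3) by (rule fun_spanE)
  have "(\<lambda>x. \<Sum>i\<in>J. \<Sum>j\<in>K. (c i * d j) * (e i x * e j x)) \<in> fun_span e"
    by (intro fun_span_sum fun_span_scale e)
  then show ?thesis by (simp add: J K sum_product mult_ac)
qed

text \<open>Identifies the torus with a compact subset of a Euclidean space, where the
  Stone--Weierstrass theorem applies.\<close>

definition torus_embedding ::
    "complex^'g^'g \<Rightarrow> complex^'g^'h \<Rightarrow> (complex^'g^'h) \<times> (complex^'g^'h)" where
  "torus_embedding \<Omega> Z =
     (\<chi> i j. cis (2 * pi * coord_p \<Omega> Z $ i $ j), \<chi> i j. cis (2 * pi * coord_q \<Omega> Z $ i $ j))"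

lemma cis_2pi_eq_iff: "cis (2 * pi * x) = cis (2 * pi * y) \<longleftrightarrow> y - x \<in> \<int>"
proof -
  have "cis (2 * pi * x) = cis (2 * pi * y) \<longleftrightarrow> cis (2 * pi * y) / cis (2 * pi * x) = 1"
    by (auto simp: divide_eq_1_iff)
  also have "\<dots> \<longleftrightarrow> exp (\<i> * of_real (2 * pi * (y - x))) = 1"
    by (simp only: cis_divide right_diff_distrib flip: cis_conv_exp)
  also have "\<dots> \<longleftrightarrow> (\<exists>n::int. 2 * pi * (y - x) = of_int (2 * n) * pi)"
    by (simp add: exp_eq_1)
  also have "\<dots> \<longleftrightarrow> (\<exists>n::int. y - x = of_int n)"
    by (intro iff_exI) auto
  also have "\<dots> \<longleftrightarrow> y - x \<in> \<int>"
    by (auto elim: Ints_cases)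
  finally show ?thesis .
qed

lemma torus_embedding_eq_iff:
  assumes "\<Omega> \<in> siegel_upper_half_space"
  shows "torus_embedding \<Omega> Z = torus_embedding \<Omega> W \<longleftrightarrow> W - Z \<in> period_lattice \<Omega>"
  unfolding torus_embedding_def period_lattice_iff[OF assms] linear_diff[OF linear_coord_p]
    linear_diff[OF linear_coord_q]
  by (auto simp: vec_eq_iff cis_2pi_eq_iff)

lemma continuous_on_torus_embedding: "continuous_on S (torus_embedding \<Omega>)"
  unfolding torus_embedding_def by (intro continuous_intros)

text \<open>Closed on all sides so as to be compact. Opposite faces give the same points of the
  torus, which is harmless: what matters is compactness and that every coset is met.\<close>

definition unit_cell :: "complex^'g^'g \<Rightarrow> (complex^'g^'h) set" where
  "unit_cell \<Omega> = {Z. \<forall>i j. coord_p \<Omega> Z $ i $ j \<in> {0..1} \<and> coord_q \<Omega> Z $ i $ j \<in> {0..1}}"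

lemma compact_unit_cell:
  fixes \<Omega> :: "complex^'g^'g"
  assumes \<Omega>: "\<Omega> \<in> siegel_upper_half_space"
  shows "compact (unit_cell \<Omega> :: (complex^'g^'h) set)"
proof -
  define B where "B = {P :: real^'g^'h. \<forall>i j. P $ i $ j \<in> {0..1}}"
  have "closed B"
    unfolding B_def atLeastAtMost_iff
    by (intro closed_Collect_all closed_Collect_conj closed_Collect_le continuous_intros)
  moreover have "bounded B"
  proof (rule boundedI)
    fix P assume P: "P \<in> B"
    show "norm P \<le> (\<Sum>i\<in>(UNIV :: 'h set). \<Sum>j\<in>(UNIV :: 'g set). 1)"
    proof -
      have "norm P \<le> (\<Sum>i\<in>UNIV. norm (P $ i))" by (rule norm_vec_le_l1)
      also have "\<dots> \<le> (\<Sum>i\<in>UNIV. \<Sum>j\<in>UNIV. norm (P $ i $ j))" by (intro sum_mono norm_vec_le_l1)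
      also have "\<dots> \<le> (\<Sum>i\<in>(UNIV :: 'h set). \<Sum>j\<in>(UNIV :: 'g set). 1)"
        using P by (intro sum_mono) (auto simp: B_def)
      finally show ?thesis .
    qed
  qed
  \<comment> \<open>The cell is the image of this product of two real cubes under the linear map
    from coordinates to points.\<close>
  ultimately have "compact (B \<times> B)" by (intro compact_Times) (simp_all add: compact_eq_bounded_closed)
  moreover have "linear (\<lambda>(P, Q). period_point \<Omega> P Q :: complex^'g^'h)"
    by (rule linearI) (auto simp: period_point_def vec_eq_iff matrix_matrix_mult_def algebra_simps
        sum.distrib sum_distrib_left scaleR_conv_of_real[where 'a = complex])
  ultimately have "compact ((\<lambda>(P, Q). period_point \<Omega> P Q) ` (B \<times> B))"
    by (intro compact_continuous_image linear_continuous_on) (simp_all add: linear_conv_bounded_linear)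
  moreover have "(\<lambda>(P, Q). period_point \<Omega> P Q) ` (B \<times> B) = unit_cell \<Omega>"
  proof (intro equalityI subsetI)
    fix Z :: "complex^'g^'h" assume "Z \<in> unit_cell \<Omega>"
    then have "(coord_p \<Omega> Z, coord_q \<Omega> Z) \<in> B \<times> B" by (auto simp: B_def unit_cell_def)
    then show "Z \<in> (\<lambda>(P, Q). period_point \<Omega> P Q) ` (B \<times> B)"
      using period_point_coords[OF \<Omega>, of Z] by (metis (no_types, lifting) case_prod_conv image_eqI)
  qed (auto simp: unit_cell_def B_def coord_p_period_point[OF \<Omega>] coord_q_period_point[OF \<Omega>])
  ultimately show ?thesis by simp
qed

lemma unit_cell_translate:
  fixes \<Omega> :: "complex^'g^'g" and Z :: "complex^'g^'h"
  assumes \<Omega>: "\<Omega> \<in> siegel_upper_half_space"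
  obtains W where "W \<in> unit_cell \<Omega>" "W - Z \<in> period_lattice \<Omega>"
proof
  let ?W = "period_point \<Omega> (\<chi> i j. frac (coord_p \<Omega> Z $ i $ j)) (\<chi> i j. frac (coord_q \<Omega> Z $ i $ j)) :: complex^'g^'h"
  note c = coord_p_period_point[OF \<Omega>] coord_q_period_point[OF \<Omega>]
  show "?W \<in> unit_cell \<Omega>"
    by (auto simp: unit_cell_def c frac_ge_0 less_imp_le[OF frac_lt_1])
  show "?W - Z \<in> period_lattice \<Omega>"
    by (simp add: period_lattice_iff[OF \<Omega>] linear_diff[OF linear_coord_p] linear_diff[OF linear_coord_q]
        c frac_def)
qed

lemma range_torus_embedding:
  fixes \<Omega> :: "complex^'g^'g"
  assumes \<Omega>: "\<Omega> \<in> siegel_upper_half_space"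
  shows "range (torus_embedding \<Omega> :: complex^'g^'h \<Rightarrow> _) = torus_embedding \<Omega> ` unit_cell \<Omega>"
proof (intro equalityI subsetI)
  fix z assume "z \<in> range (torus_embedding \<Omega> :: complex^'g^'h \<Rightarrow> _)"
  then obtain Z :: "complex^'g^'h" where Z: "z = torus_embedding \<Omega> Z" by blast
  obtain W where W: "W \<in> unit_cell \<Omega>" "W - Z \<in> period_lattice \<Omega>" using unit_cell_translate[OF \<Omega>] .
  then have "z = torus_embedding \<Omega> W" by (simp add: Z torus_embedding_eq_iff[OF \<Omega>])
  then show "z \<in> torus_embedding \<Omega> ` unit_cell \<Omega>" using W(1) by blast
qed blast

section \<open>Uniform and mean square density of trigonometric polynomials\<close>

text \<open>The span of the characters is an algebra, since products of characters are characters,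
  and it is closed under conjugation. Real and imaginary parts of the embedding's entries therefore
  belong to it, and they separate the points of the compact image.\<close>

lemma uniform_approx_by_chars:
  fixes \<Omega> :: "complex^'g^'g" and F :: "(complex^'g^'h) \<times> (complex^'g^'h) \<Rightarrow> real"
  assumes \<Omega>: "\<Omega> \<in> siegel_upper_half_space"
    and F: "continuous_on (range (torus_embedding \<Omega>)) F" and "\<epsilon> > 0"
  shows "\<exists>t\<in>fun_span (\<lambda>(A, B). lattice_char \<Omega> A B).
    \<forall>Z. cmod (complex_of_real (F (torus_embedding \<Omega> Z)) - t Z) < \<epsilon>"
proof -
  let ?e = "\<lambda>(A, B). lattice_char \<Omega> A B :: complex^'g^'h \<Rightarrow> complex"
  let ?K = "range (torus_embedding \<Omega> :: complex^'g^'h \<Rightarrow> _)"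
  \<comment> \<open>The real Stone--Weierstrass theorem needs an algebra of real functions on the
    image, so \<open>P\<close> selects the real functions whose pullback is a complex trigonometric
    polynomial.\<close>
  define P where "P G \<longleftrightarrow> continuous_on ?K G \<and>
    (\<lambda>Z. complex_of_real (G (torus_embedding \<Omega> Z))) \<in> fun_span ?e" for G
  have base: "lattice_char \<Omega> A B \<in> fun_span ?e" for A B
    using fun_span_base[of ?e "(A, B)"] by simp
  have one: "(\<lambda>Z. 1) \<in> fun_span ?e"
  proof -
    have "lattice_char \<Omega> 0 0 = (\<lambda>Z :: complex^'g^'h. 1)" by (rule ext) (rule lattice_char_0[OF \<Omega>])
    then show ?thesis using base[of 0 0] by simp
  qed
  have mult: "(\<lambda>Z. s Z * t Z) \<in> fun_span ?e" if "s \<in> fun_span ?e" "t \<in> fun_span ?e" for s t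
  proof (rule fun_span_mult[OF _ that])
    show "(\<lambda>x. ?e i x * ?e j x) \<in> fun_span ?e" for i j
      using base by (cases i; cases j) (simp add: lattice_char_mult[OF \<Omega>])
  qed
  \<comment> \<open>Matrix units: taken as \<open>A\<close> or as \<open>B\<close>, they turn the
    individual entries of the embedding into characters.\<close>
  define E where "E k l = (\<chi> i j. if i = k \<and> j = l then 1 else (0::int))" for k :: 'h and l :: 'g
  have if_mult: "(if b then 1 else 0) * y = (if b then y else 0)"
    "of_int (if b then 1 else 0) * y = (if b then y else 0)" for y :: real and b by simp_all
  have char_E: "cis (2 * pi * coord_p \<Omega> Z $ k $ l) = lattice_char \<Omega> (E k l) 0 Z"
    "cis (2 * pi * coord_q \<Omega> Z $ k $ l) = lattice_char \<Omega> 0 (E k l) Z"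
    for k l and Z :: "complex^'g^'h"
    unfolding lattice_char_coords[OF \<Omega>] by (simp_all add: E_def if_mult sum_entries_axis)
  have cnj_char: "cnj (lattice_char \<Omega> A B Z) = lattice_char \<Omega> (- A) (- B) Z"
    for A B and Z :: "complex^'g^'h"
    using lattice_char_mult_cnj[OF \<Omega>, of 0 0 Z A B] by (simp add: lattice_char_0[OF \<Omega>])
  have re: "complex_of_real (Re w) = (1/2) * w + (1/2) * cnj w" for w
    by (simp add: complex_eq_iff)
  have im: "complex_of_real (Im w) = (-\<i>/2) * w + (\<i>/2) * cnj w" for w
    by (simp add: complex_eq_iff)
  have sep: "P (\<lambda>z. Re (fst z $ k $ l))" "P (\<lambda>z. Im (fst z $ k $ l))"
    "P (\<lambda>z. Re (snd z $ k $ l))" "P (\<lambda>z. Im (snd z $ k $ l))" for k l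
    unfolding P_def torus_embedding_def fst_conv snd_conv vec_lambda_beta re im char_E cnj_char
    by (intro conjI continuous_intros fun_span_add fun_span_scale base)+
  have "\<exists>G. P G \<and> (\<forall>z\<in>?K. \<bar>F z - G z\<bar> < \<epsilon>)"
  proof (rule Stone_Weierstrass_HOL)
    show "compact ?K"
      unfolding range_torus_embedding[OF \<Omega>]
      by (intro compact_continuous_image continuous_on_torus_embedding compact_unit_cell[OF \<Omega>])
    show "P (\<lambda>x. c)" for c
      unfolding P_def using fun_span_scale[OF one, of "of_real c"] by simp
    show "P G \<Longrightarrow> continuous_on ?K G" for G by (simp add: P_def)
    show "P (\<lambda>x. f x + g x)" if "P f \<and> P g" for f g
      using that unfolding P_def of_real_add by (intro conjI continuous_on_add fun_span_add) auto
    show "P (\<lambda>x. f x * g x)" if "P f \<and> P g" for f g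
      using that unfolding P_def of_real_mult by (intro conjI continuous_on_mult mult) auto
    show "\<exists>f. P f \<and> f x \<noteq> f y" if xy: "x \<in> ?K \<and> y \<in> ?K \<and> x \<noteq> y" for x y
    proof -
      obtain k l where "fst x $ k $ l \<noteq> fst y $ k $ l \<or> snd x $ k $ l \<noteq> snd y $ k $ l"
        using xy by (auto simp: prod_eq_iff vec_eq_iff)
      then consider "Re (fst x $ k $ l) \<noteq> Re (fst y $ k $ l)" | "Im (fst x $ k $ l) \<noteq> Im (fst y $ k $ l)"
        | "Re (snd x $ k $ l) \<noteq> Re (snd y $ k $ l)" | "Im (snd x $ k $ l) \<noteq> Im (snd y $ k $ l)"
        by (auto simp: complex_eq_iff)
      then show ?thesis by cases (rule exI, rule conjI, rule sep, assumption)+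
    qed
  qed (use F \<open>\<epsilon> > 0\<close> in auto)
  then obtain G where G: "P G" "\<And>Z. \<bar>F (torus_embedding \<Omega> Z) - G (torus_embedding \<Omega> Z)\<bar> < \<epsilon>" by auto
  show ?thesis
  proof (intro bexI allI)
    show "(\<lambda>Z. complex_of_real (G (torus_embedding \<Omega> Z))) \<in> fun_span ?e" using G(1) by (simp add: P_def)
    show "cmod (complex_of_real (F (torus_embedding \<Omega> Z)) - complex_of_real (G (torus_embedding \<Omega> Z))) < \<epsilon>" for Z
      using G(2)[of Z] by (simp flip: of_real_diff)
  qed
qed

text \<open>The truncated distances tend only pointwise to the indicator, but each is uniformly
  approximated by characters within 1/(n+1), so the approximants have the same limit. The uniform
  bound is what dominated convergence will use.\<close>

lemma open_indicator_limit_of_chars: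
  fixes \<Omega> :: "complex^'g^'g" and S :: "(complex^'g^'h) set set"
  assumes \<Omega>: "\<Omega> \<in> siegel_upper_half_space" and S: "S \<subseteq> torus \<Omega>" "open (\<Union>S)"
  obtains t :: "nat \<Rightarrow> (complex^'g^'h) set \<Rightarrow> complex"
  where "\<And>n. t n \<in> fun_span (\<lambda>(A, B). torus_char \<Omega> A B)"
    "\<And>C. C \<in> torus \<Omega> \<Longrightarrow> (\<lambda>n. t n C) \<longlonglongrightarrow> indicator S C"
    "\<And>n C. C \<in> torus \<Omega> \<Longrightarrow> cmod (t n C) \<le> 2"
proof -
  let ?\<Phi> = "torus_embedding \<Omega> :: complex^'g^'h \<Rightarrow> _"
  define U where "U = \<Union>S"
  \<comment> \<open>The point 0, which is not in the range of the embedding, only ensures that \<open>N\<close> is nonempty,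
    since \<open>infdist z {} = 0\<close>.\<close>
  define N where "N = insert 0 (?\<Phi> ` (unit_cell \<Omega> - U))"
  have U: "Z \<in> U \<longleftrightarrow> torus_proj \<Omega> Z \<in> S" for Z
    unfolding U_def by (rule in_Union_torus[OF S(1)])
  \<comment> \<open>Cutting the complement down to the cell gives compactness without losing points
    of its image: \<open>U\<close> is invariant under periods, so every point outside
    \<open>U\<close> has a translate in the cell that is also outside \<open>U\<close>.\<close>
  have "compact (unit_cell \<Omega> - U)"
    using compact_unit_cell[OF \<Omega>] S(2) unfolding U_def by (rule compact_diff)
  then have "closed N"
    unfolding N_def
    by (intro closed_insert compact_imp_closed compact_continuous_image continuous_on_torus_embedding)
  have N: "?\<Phi> Z \<in> N \<longleftrightarrow> Z \<notin> U" for Z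
  proof
    assume "?\<Phi> Z \<in> N"
    moreover have "?\<Phi> Z \<noteq> 0" by (simp add: torus_embedding_def vec_eq_iff prod_eq_iff)
    ultimately obtain W where W: "W \<notin> U" "?\<Phi> Z = ?\<Phi> W" by (auto simp: N_def)
    then have "torus_proj \<Omega> Z = torus_proj \<Omega> W"
      by (simp add: torus_embedding_eq_iff[OF \<Omega>] torus_proj_eq_iff)
    then show "Z \<notin> U" using W(1) by (simp add: U)
  next
    assume Z: "Z \<notin> U"
    obtain W where W: "W \<in> unit_cell \<Omega>" "W - Z \<in> period_lattice \<Omega>" using unit_cell_translate[OF \<Omega>] .
    then have "torus_proj \<Omega> Z = torus_proj \<Omega> W" "?\<Phi> Z = ?\<Phi> W"
      by (simp_all add: torus_embedding_eq_iff[OF \<Omega>] torus_proj_eq_iff)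
    then show "?\<Phi> Z \<in> N" using W Z by (auto simp: N_def U)
  qed
  \<comment> \<open>It vanishes on \<open>N\<close>, and at any other point it equals 1 once
    \<open>n\<close> exceeds the reciprocal of the distance to \<open>N\<close>.\<close>
  define F where "F n z = min 1 (real n * infdist z N)" for n z
  have approx: "\<exists>t\<in>fun_span (\<lambda>(A, B). lattice_char \<Omega> A B).
      \<forall>Z. cmod (complex_of_real (F n (?\<Phi> Z)) - t Z) < inverse (real (Suc n))" for n
    unfolding F_def
    by (rule uniform_approx_by_chars[OF \<Omega>]) (auto intro!: continuous_intros)
  have "\<forall>n. \<exists>t. t \<in> fun_span (\<lambda>(A, B). torus_char \<Omega> A B) \<and>
      (\<forall>Z. cmod (complex_of_real (F n (?\<Phi> Z)) - t (torus_proj \<Omega> Z)) < inverse (real (Suc n)))"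
  proof
    fix n
    obtain s where s: "s \<in> fun_span (\<lambda>(A, B). lattice_char \<Omega> A B)"
      "\<And>Z. cmod (complex_of_real (F n (?\<Phi> Z)) - s Z) < inverse (real (Suc n))" using approx[of n] by blast
    obtain J c where J: "finite J" "s = (\<lambda>x. \<Sum>j\<in>J. c j * (case j of (A, B) \<Rightarrow> lattice_char \<Omega> A B) x)"
      using s(1) by (rule fun_spanE)
    \<comment> \<open>The same indices and coefficients give the approximant on the torus, because
      \<open>torus_char\<close> composed with the projection is \<open>lattice_char\<close>.\<close>
    have "s Z = (\<Sum>j\<in>J. c j * (case j of (A, B) \<Rightarrow> torus_char \<Omega> A B) (torus_proj \<Omega> Z))" for Z
      by (simp add: J(2) torus_char_proj[OF \<Omega>] split_beta)
    then show "\<exists>t. t \<in> fun_span (\<lambda>(A, B). torus_char \<Omega> A B) \<and>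
        (\<forall>Z. cmod (complex_of_real (F n (?\<Phi> Z)) - t (torus_proj \<Omega> Z)) < inverse (real (Suc n)))"
      using s(2) fun_spanI[OF J(1)] by (intro exI conjI allI) auto
  qed
  from choice[OF this] obtain t where t_span: "\<And>n. t n \<in> fun_span (\<lambda>(A, B). torus_char \<Omega> A B)"
    and t: "\<And>n Z. cmod (complex_of_real (F n (?\<Phi> Z)) - t n (torus_proj \<Omega> Z)) < inverse (real (Suc n))"
    by blast
  have F01: "0 \<le> F n z" "F n z \<le> 1" for n z by (auto simp: F_def infdist_nonneg)
  show ?thesis
  proof
    show "t n \<in> fun_span (\<lambda>(A, B). torus_char \<Omega> A B)" for n
      by (rule t_span)
  next
    fix n and C :: "(complex^'g^'h) set" assume "C \<in> torus \<Omega>"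
    then obtain Z where Z: "C = torus_proj \<Omega> Z" by (rule torusE)
    have "cmod (t n C) \<le> cmod (complex_of_real (F n (?\<Phi> Z))) + cmod (complex_of_real (F n (?\<Phi> Z)) - t n C)"
      by (metis norm_triangle_sub norm_minus_commute)
    also have "\<dots> \<le> 1 + inverse (real (Suc n))"
      using t[of n Z] F01 unfolding Z by (intro add_mono) auto
    also have "\<dots> \<le> 2" by (simp add: field_simps)
    finally show "cmod (t n C) \<le> 2" .
  next
    fix C :: "(complex^'g^'h) set" assume "C \<in> torus \<Omega>"
    then obtain Z where Z: "C = torus_proj \<Omega> Z" by (rule torusE)
    have lim: "(\<lambda>n. complex_of_real (F n (?\<Phi> Z))) \<longlonglongrightarrow> indicator S C"
    proof (cases "Z \<in> U")
      case True
      then have "?\<Phi> Z \<notin> N" by (simp add: N)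
      then have pos: "infdist (?\<Phi> Z) N > 0"
        using \<open>closed N\<close> by (simp add: N_def infdist_pos_not_in_closed)
      then obtain m where m: "1 < real m * infdist (?\<Phi> Z) N" using reals_Archimedean3 by blast
      have "F n (?\<Phi> Z) = 1" if "n \<ge> m" for n
      proof -
        have "real m * infdist (?\<Phi> Z) N \<le> real n * infdist (?\<Phi> Z) N"
          using that by (intro mult_right_mono infdist_nonneg) simp
        then show ?thesis using m by (simp add: F_def)
      qed
      then have "\<forall>\<^sub>F n in sequentially. complex_of_real (F n (?\<Phi> Z)) = indicator S C"
        using True by (auto simp: eventually_sequentially U Z)
      then show ?thesis by (rule tendsto_eventually)
    next
      case False
      then have "infdist (?\<Phi> Z) N = 0" by (simp add: N)
      then show ?thesis using False by (simp add: F_def U Z)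
    qed
    have "(\<lambda>n. complex_of_real (F n (?\<Phi> Z)) - t n C) \<longlonglongrightarrow> 0"
      by (rule Lim_null_comparison[OF _ LIMSEQ_inverse_real_of_nat])
        (use t[of _ Z] in \<open>auto simp: Z less_imp_le\<close>)
    from tendsto_diff[OF lim this] show "(\<lambda>n. t n C) \<longlonglongrightarrow> indicator S C" by simp
  qed
qed

lemma torus_char_sq_integrable:
  fixes \<Omega> :: "complex^'g^'g" and dv :: "(complex^'g^'h) set measure"
  assumes \<Omega>: "\<Omega> \<in> siegel_upper_half_space" and dv: "normalized_invariant_volume \<Omega> dv"
  shows "sq_integrable dv ((\<lambda>(A, B). torus_char \<Omega> A B) i)"
proof -
  have sp: "space dv = torus \<Omega>" and st: "sets dv = sets (torus_borel \<Omega>)" and one: "emeasure dv (space dv) = 1"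
    using dv by (auto simp: normalized_invariant_volume_def)
  interpret finite_measure dv by (rule finite_measureI) (simp add: one)
  have meas: "torus_char \<Omega> A B \<in> borel_measurable dv" for A B
    using torus_char_measurable[OF \<Omega>] by (simp add: measurable_cong_sets[OF st refl])
  have cm: "cmod (torus_char \<Omega> A B x) = 1" if "x \<in> torus \<Omega>" for A B x
    using that by (auto elim!: torusE simp: torus_char_proj[OF \<Omega>] cmod_lattice_char[OF \<Omega>])
  show ?thesis
    by (cases i) (auto intro!: sq_integrable_bounded[where C = 1] meas simp: cm sp)
qed

lemma torus_char_dense:
  fixes \<Omega> :: "complex^'g^'g" and dv :: "(complex^'g^'h) set measure"
  assumes \<Omega>: "\<Omega> \<in> siegel_upper_half_space" and dv: "normalized_invariant_volume \<Omega> dv"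
    and f: "sq_integrable dv f"
  shows "mean_square_approximable dv (fun_span (\<lambda>(A, B). torus_char \<Omega> A B)) f"
proof -
  let ?e = "\<lambda>(A, B). torus_char \<Omega> A B :: (complex^'g^'h) set \<Rightarrow> complex"
  let ?G = "{S. S \<subseteq> torus \<Omega> \<and> open (\<Union>S)} :: (complex^'g^'h) set set set"
  have sp: "space dv = torus \<Omega>" and st: "sets dv = sets (torus_borel \<Omega>)" and one: "emeasure dv (space dv) = 1"
    using dv by (auto simp: normalized_invariant_volume_def)
  interpret finite_measure dv by (rule finite_measureI) (simp add: one)
  have si: "sq_integrable dv (?e i)" for i by (rule torus_char_sq_integrable[OF \<Omega> dv])
  have T_si: "sq_integrable dv t" if t: "t \<in> fun_span ?e" for t
  proof -
    obtain J c where "finite J" "t = (\<lambda>x. \<Sum>j\<in>J. c j * ?e j x)" using t by (rule fun_spanE)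
    then show ?thesis using sq_integrable_lincomb[of J dv ?e c, OF si] by simp
  qed
  interpret mean_square_subspace dv "fun_span ?e" "torus_char \<Omega> 0 0"
  proof unfold_locales
    show "torus_char \<Omega> 0 0 \<in> fun_span ?e" using fun_span_base[of ?e "(0, 0)"] by simp
    show "torus_char \<Omega> 0 0 x = 1" if "x \<in> space dv" for x
      using that by (auto simp: sp torus_char_proj[OF \<Omega>] lattice_char_0[OF \<Omega>] elim!: torusE)
  qed (fact T_si fun_span_add fun_span_scale)+
  show ?thesis
  proof (rule mean_square_approximable_all[of ?G, OF _ _ _ _ f])
    show "sets dv = sigma_sets (space dv) ?G" by (simp add: st sets_torus_borel sp)
    show "?G \<subseteq> Pow (space dv)" by (auto simp: sp)
    show "Int_stable ?G"
    proof (rule Int_stableI)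
      fix R S assume R: "R \<in> ?G" and S: "S \<in> ?G"
      \<comment> \<open>For general families of sets only one inclusion holds; here both do, because
        each point lies in exactly one coset.\<close>
      have "Z \<in> \<Union>(R \<inter> S) \<longleftrightarrow> Z \<in> \<Union>R \<inter> \<Union>S" for Z
        using R S in_Union_torus[of R \<Omega> Z] in_Union_torus[of S \<Omega> Z] in_Union_torus[of "R \<inter> S" \<Omega> Z] by auto
      then have "\<Union>(R \<inter> S) = \<Union>R \<inter> \<Union>S" by blast
      then show "R \<inter> S \<in> ?G" using R S by (auto simp: open_Int)
    qed
    fix S assume S: "S \<in> ?G"
    then have Sm: "S \<in> sets dv" unfolding st sets_torus_borel by (rule sigma_sets.Basic)
    obtain t where t: "\<And>n. t n \<in> fun_span ?e"
      "\<And>C. C \<in> torus \<Omega> \<Longrightarrow> (\<lambda>n. t n C) \<longlonglongrightarrow> indicator S C"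
      "\<And>n C. C \<in> torus \<Omega> \<Longrightarrow> cmod (t n C) \<le> 2"
      using open_indicator_limit_of_chars[OF \<Omega>] S by blast
    show "mean_square_approximable dv (fun_span ?e) (indicator S)"
    proof (rule approximable_limit[OF sq_integrable_indicator[OF Sm] T_si[OF t(1)] approximable_of_T[OF t(1)]])
      show "(\<lambda>n. LINT x|dv. (cmod (indicator S x - t n x))\<^sup>2) \<longlonglongrightarrow> 0"
      \<comment> \<open>The constant is 9 = (1 + 2)^2: the indicator is at most 1 and
        \<open>t n\<close> at most 2 in modulus.\<close>
      proof (rule square_error_tendsto_0[where w = "\<lambda>_. 9"])
        show "(cmod (indicator S x - t n x))\<^sup>2 \<le> 9" if "x \<in> space dv" for n x
        proof -
          have "cmod (indicator S x - t n x) \<le> cmod (indicator S x) + cmod (t n x)"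
            by (rule norm_triangle_ineq4)
          also have "\<dots> \<le> 1 + 2"
            using t(3) that by (intro add_mono) (auto simp: sp indicator_def)
          finally have "(cmod (indicator S x - t n x))\<^sup>2 \<le> 3\<^sup>2" by (intro power_mono) auto
          then show ?thesis by simp
        qed
      qed (use Sm t sp in \<open>auto intro: sq_integrable_measurable[OF T_si]\<close>)
    qed
  qed
qed

section \<open>Eigenfunctions\<close>

text \<open>The factor \<open>c\<close> makes the family of functions
  \<open>c * cis (\<theta> x)\<close> closed under directional derivatives, so that iterated
  derivatives stay within it.\<close>

lemma has_derivative_cis_linear:
  fixes \<theta> :: "'v::real_normed_vector \<Rightarrow> real"
  assumes "bounded_linear \<theta>"
  shows "((\<lambda>x. c * cis (\<theta> x)) has_derivative (\<lambda>v. c * (\<i> * of_real (\<theta> v)) * cis (\<theta> x))) (at x)"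
proof -
  have "((\<lambda>x. exp (\<i> * of_real (\<theta> x))) has_derivative (\<lambda>v. exp (\<i> * of_real (\<theta> x)) * (\<i> * of_real (\<theta> v)))) (at x)"
  proof (rule has_derivative_compose[where g = exp and g' = "(*) (exp (\<i> * of_real (\<theta> x)))"])
    show "((\<lambda>x. \<i> * complex_of_real (\<theta> x)) has_derivative (\<lambda>v. \<i> * complex_of_real (\<theta> v))) (at x)"
      by (intro has_derivative_mult_right has_derivative_of_real bounded_linear_imp_has_derivative[OF assms])
    show "(exp has_derivative (*) (exp (\<i> * of_real (\<theta> x)))) (at (\<i> * of_real (\<theta> x)))"
      using DERIV_exp unfolding has_field_derivative_def .
  qed
  from has_derivative_mult_right[OF this, of c] show ?thesis
    by (simp add: cis_conv_exp mult_ac)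
qed

lemma dir_deriv_cis_linear:
  assumes "bounded_linear \<theta>"
  shows "dir_deriv v (\<lambda>x. c * cis (\<theta> x)) = (\<lambda>x. c * (\<i> * of_real (\<theta> v)) * cis (\<theta> x))"
  unfolding dir_deriv_def using frechet_derivative_at[OF has_derivative_cis_linear[OF assms]] by (simp add: fun_eq_iff)

lemma smooth_fun_cis_linear:
  assumes "bounded_linear \<theta>"
  shows "smooth_fun (\<lambda>x. c * cis (\<theta> x))"
proof -
  have "\<exists>d. foldr dir_deriv vs (\<lambda>x. c * cis (\<theta> x)) = (\<lambda>x. d * cis (\<theta> x))" for vs
    by (induction vs) (auto simp: dir_deriv_cis_linear[OF assms])
  then show ?thesis
    unfolding smooth_fun_def using has_derivative_cis_linear[OF assms]
    by (metis differentiable_def)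
qed

lemma laplacian_cis_linear:
  fixes \<theta> :: "complex^'g^'h \<Rightarrow> real"
  assumes "bounded_linear \<theta>"
  shows "\<exists>\<mu>. \<forall>Z. laplacian \<Omega> (\<lambda>Z. cis (\<theta> Z)) Z = \<mu> * cis (\<theta> Z)"
proof -
  \<comment> \<open>The constants by which the Wirtinger derivatives multiply
    \<open>cis (\<theta> Z)\<close>: \<open>a\<close> belongs to the conjugate derivative and
    \<open>b\<close> to the holomorphic one. The eigenvalue is the trace of Y times the matrix of
    the sums over \<open>k\<close> of their products.\<close>
  define a where "a m k = (\<i> * of_real (\<theta> (axis k (axis m 1))) + \<i> * (\<i> * of_real (\<theta> (axis k (axis m \<i>))))) / 2"
    for m k
  define b where "b l k = (\<i> * of_real (\<theta> (axis k (axis l 1))) - \<i> * (\<i> * of_real (\<theta> (axis k (axis l \<i>))))) / 2"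
    for l k
  have 1: "d_dZbar m k (\<lambda>Z. cis (\<theta> Z)) = (\<lambda>Z. a m k * cis (\<theta> Z))" for m k
    using dir_deriv_cis_linear[OF assms, of _ 1]
    by (auto simp: fun_eq_iff d_dZbar_def a_def field_simps)
  have 2: "d_dZ l k (\<lambda>Z. c * cis (\<theta> Z)) = (\<lambda>Z. c * b l k * cis (\<theta> Z))" for l k c
    by (auto simp: fun_eq_iff d_dZ_def b_def dir_deriv_cis_linear[OF assms] field_simps)
  let ?Y = "map_matrix complex_of_real (map_matrix Im \<Omega>)"
  have "laplacian \<Omega> (\<lambda>Z. cis (\<theta> Z)) Z =
      trace (?Y ** (\<chi> l m. \<Sum>k\<in>UNIV. a m k * b l k)) * cis (\<theta> Z)" for Z
    unfolding laplacian_def 1 2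
    by (simp add: trace_def matrix_matrix_mult_def sum_distrib_left sum_distrib_right mult_ac)
  then show ?thesis by blast
qed

lemma torus_char_eigenfunction:
  fixes \<Omega> :: "complex^'g^'g" and A B :: "int^'g^'h"
  assumes \<Omega>: "\<Omega> \<in> siegel_upper_half_space"
  shows "laplacian_eigenfunction \<Omega> (torus_char \<Omega> A B)"
proof -
  define \<theta> where "\<theta> Z = 2 * pi * (\<Sum>i\<in>UNIV. \<Sum>j\<in>UNIV.
    of_int (A $ i $ j) * coord_p \<Omega> Z $ i $ j + of_int (B $ i $ j) * coord_q \<Omega> Z $ i $ j)"
    for Z :: "complex^'g^'h"
  have "linear \<theta>"
    unfolding \<theta>_def
    by (rule linearI) (simp_all add: coord_p_add coord_q_add coord_p_scaleR coord_q_scaleR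
        sum.distrib sum_distrib_left algebra_simps)
  then have bl: "bounded_linear \<theta>" by (simp add: linear_conv_bounded_linear)
  have "torus_char \<Omega> A B (torus_proj \<Omega> Z) = cis (\<theta> Z)" for Z
    by (simp add: torus_char_proj[OF \<Omega>] lattice_char_coords[OF \<Omega>] \<theta>_def)
  then show ?thesis
    unfolding laplacian_eigenfunction_def
    using smooth_fun_cis_linear[OF bl, of 1] laplacian_cis_linear[OF bl, of \<Omega>] by simp
qed

theorem theorem4p1:
  fixes \<Omega> :: "complex^'g^'g" and dv :: "(complex^'g^'h) set measure"
  assumes "\<Omega> \<in> siegel_upper_half_space"
    and "normalized_invariant_volume \<Omega> dv"
  shows "L2_complete_orthonormal_basis dv UNIV
           (\<lambda>(A, B). ae_class dv (torus_char \<Omega> A B))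
       \<and> (\<forall>A B :: int^'g^'h. laplacian_eigenfunction \<Omega> (torus_char \<Omega> A B))
       \<and> L2_hilbert_direct_sum dv UNIV
           (\<lambda>(A, B). L2_line dv (ae_class dv (torus_char \<Omega> A B)))"
proof (intro conjI allI)
  note \<Omega> = assms(1) and dv = assms(2)
  let ?e = "\<lambda>(A, B). torus_char \<Omega> A B :: (complex^'g^'h) set \<Rightarrow> complex"
  have class_e: "(\<lambda>(A, B). ae_class dv (torus_char \<Omega> A B)) = (\<lambda>i. ae_class dv (?e i))"
    by (simp add: fun_eq_iff)
  have "L2_complete_orthonormal_basis dv UNIV (\<lambda>i. ae_class dv (?e i))"
    unfolding L2_complete_orthonormal_basis_ae_class[of UNIV dv ?e, OF torus_char_sq_integrable[OF \<Omega> dv]]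
  proof (intro conjI ballI allI impI)
    show "(LINT x|dv. ?e i x * cnj (?e j x)) = (if i = j then 1 else 0)" for i j
      using torus_char_orthonormal[OF \<Omega> dv] by (cases i; cases j) simp
    fix f and \<epsilon> :: real assume "sq_integrable dv f" "\<epsilon> > 0"
    then obtain t where "t \<in> fun_span ?e" "(LINT x|dv. (cmod (f x - t x))\<^sup>2) < \<epsilon>"
      using torus_char_dense[OF \<Omega> dv] unfolding mean_square_approximable_def by blast
    then show "\<exists>J c. finite J \<and> J \<subseteq> UNIV \<and> (LINT x|dv. (cmod (f x - (\<Sum>j\<in>J. c j * ?e j x)))\<^sup>2) < \<epsilon>"
      by (auto elim!: fun_spanE)
  qed
  then show basis: "L2_complete_orthonormal_basis dv UNIV (\<lambda>(A, B). ae_class dv (torus_char \<Omega> A B))"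
    by (simp only: class_e)
  show "laplacian_eigenfunction \<Omega> (torus_char \<Omega> A B)" for A B :: "int^'g^'h"
    by (rule torus_char_eigenfunction[OF \<Omega>])
  show "L2_hilbert_direct_sum dv UNIV (\<lambda>(A, B). L2_line dv (ae_class dv (torus_char \<Omega> A B)))"
    using L2_hilbert_direct_sum_if_basis[OF basis] by (simp add: split_beta')
qed

end
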